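(* Each element $f$ of $\mathrm{Diffeo}(\mathbb{R})$ that is reversible in $\mathrm{Diffeo}(\mathbb{R})$ satisfies at least one of the following: (i) $f$ is strongly reversible in $\mathrm{Diffeo}(\mathbb{R})$; (ii) $f$ is an element of $\mathrm{Diffeo}^+(\mathbb{R})$ that is reversible in $\mathrm{Diffeo}^+(\mathbb{R})$.
   Context: A diffeomorphism of $\mathbb{R}$ is an infinitely differentiable homeomorphism of $\mathbb{R}$ onto itself whose derivative never vanishes. $\mathrm{Diffeo}(\mathbb{R})$ is the group of all diffeomorphisms of $\mathbb{R}$ under composition, and $\mathrm{Diffeo}^+(\mathbb{R})$ is its subgroup of order preserving (strictly increasing) diffeomorphisms. An element $f$ of a group $G$ is reversible in $G$ if there is $h\in G$ with $hfh^{-1}=f^{-1}$. An involution in $G$ is an element $\tau$ with $\tau^2$ equal to the identity (the identity itself is allowed). An element $f$ of $G$ is strongly reversible in $G$ if there is an involution $\tau\in G$ with $\tau f\tau^{-1}=f^{-1}$. *)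

theory Defs
  imports "HOL-Analysis.Analysis" "HOL-Algebra.Group"
begin

section \<open>The diffeomorphism groups of the real line\<close>

definition smooth :: "(real \<Rightarrow> real) \<Rightarrow> bool" where
  "smooth f \<longleftrightarrow> (\<forall>n x. (deriv ^^ n) f differentiable (at x))"

definition diffeomorphism :: "(real \<Rightarrow> real) \<Rightarrow> bool" where
  "diffeomorphism f \<longleftrightarrow>
     smooth f \<and> (\<exists>g. homeomorphism UNIV UNIV f g) \<and> (\<forall>x. deriv f x \<noteq> 0)"

definition Diffeo :: "(real \<Rightarrow> real) monoid" where
  "Diffeo = \<lparr>carrier = {f. diffeomorphism f}, mult = (\<circ>), one = id\<rparr>"

definition Diffeo_plus :: "(real \<Rightarrow> real) monoid" where
  "Diffeo_plus = Diffeo\<lparr>carrier := {f \<in> carrier Diffeo. strict_mono f}\<rparr>"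

section \<open>Reversibility in a group\<close>

definition reversible :: "('a, 'b) monoid_scheme \<Rightarrow> 'a \<Rightarrow> bool" where
  "reversible G f \<longleftrightarrow>
     (\<exists>h \<in> carrier G. h \<otimes>\<^bsub>G\<^esub> f \<otimes>\<^bsub>G\<^esub> inv\<^bsub>G\<^esub> h = inv\<^bsub>G\<^esub> f)"

text \<open>The identity counts as an involution.\<close>

definition involution :: "('a, 'b) monoid_scheme \<Rightarrow> 'a \<Rightarrow> bool" where
  "involution G t \<longleftrightarrow> t \<in> carrier G \<and> t \<otimes>\<^bsub>G\<^esub> t = \<one>\<^bsub>G\<^esub>"

definition strongly_reversible :: "('a, 'b) monoid_scheme \<Rightarrow> 'a \<Rightarrow> bool" where
  "strongly_reversible G f \<longleftrightarrow>
     (\<exists>t. involution G t \<and> t \<otimes>\<^bsub>G\<^esub> f \<otimes>\<^bsub>G\<^esub> inv\<^bsub>G\<^esub> t = inv\<^bsub>G\<^esub> f)"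

section \<open>The group axioms\<close>

definition diff_times :: "nat \<Rightarrow> (real \<Rightarrow> real) \<Rightarrow> bool" where
  "diff_times n f \<longleftrightarrow> (\<forall>k<n. \<forall>x. (deriv ^^ k) f differentiable (at x))"

lemma smooth_iff_diff_times: "smooth f \<longleftrightarrow> (\<forall>n. diff_times n f)"
  unfolding smooth_def diff_times_def by blast

lemma diff_times_0 [simp]: "diff_times 0 f"
  by (simp add: diff_times_def)

lemma diff_times_Suc:
  "diff_times (Suc n) f \<longleftrightarrow> (\<forall>x. f differentiable (at x)) \<and> diff_times n (deriv f)"
proof -
  have "(deriv ^^ Suc k) f = (deriv ^^ k) (deriv f)" for k
    by (simp add: funpow_swap1)
  then show ?thesis
    unfolding diff_times_def
    by (metis Suc_less_eq funpow_0 less_Suc_eq_0_disj zero_less_Suc)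
qed

lemma diff_times_SucD: "diff_times (Suc n) f \<Longrightarrow> diff_times n f"
  by (simp add: diff_times_def)

lemma diff_times_SucI:
  assumes "\<And>x. (f has_real_derivative g x) (at x)" and "diff_times n g"
  shows "diff_times (Suc n) f"
proof -
  have "deriv f = g"
    using assms(1) by (intro ext DERIV_imp_deriv)
  then show ?thesis
    using assms by (auto simp: diff_times_Suc real_differentiable_def)
qed

lemma diff_times_Suc_DERIV:
  assumes "diff_times (Suc n) f"
  shows "(f has_real_derivative deriv f x) (at x)"
  using assms by (simp add: diff_times_Suc DERIV_deriv_iff_real_differentiable)

lemma diff_times_const: "diff_times n (\<lambda>_. c)"
proof (induction n arbitrary: c)
  case (Suc n)
  show ?case
    by (rule diff_times_SucI[OF _ Suc]) (auto intro!: derivative_eq_intros)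
qed simp

lemma diff_times_id: "diff_times n id"
proof (cases n)
  case (Suc m)
  show ?thesis
    unfolding Suc id_def
    by (rule diff_times_SucI[OF _ diff_times_const[of _ 1]]) (auto intro!: derivative_eq_intros)
qed simp

lemma diff_times_add:
  "diff_times n f \<Longrightarrow> diff_times n g \<Longrightarrow> diff_times n (\<lambda>x. f x + g x)"
proof (induction n arbitrary: f g)
  case (Suc n)
  note D = diff_times_Suc_DERIV[OF Suc.prems(1)] diff_times_Suc_DERIV[OF Suc.prems(2)]
  show ?case
    by (rule diff_times_SucI[OF DERIV_add[OF D]])
      (use Suc in \<open>simp add: diff_times_Suc\<close>)
qed simp

lemma diff_times_mult:
  "diff_times n f \<Longrightarrow> diff_times n g \<Longrightarrow> diff_times n (\<lambda>x. f x * g x)"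
proof (induction n arbitrary: f g)
  case (Suc n)
  note D = diff_times_Suc_DERIV[OF Suc.prems(1)] diff_times_Suc_DERIV[OF Suc.prems(2)]
  have "diff_times n f" "diff_times n g"
    using Suc.prems by (auto intro: diff_times_SucD)
  then show ?case
    by (intro diff_times_SucI[OF DERIV_mult[OF D]] diff_times_add Suc.IH)
      (use Suc.prems in \<open>simp_all add: diff_times_Suc\<close>)
qed simp

lemma diff_times_inverse:
  "diff_times n f \<Longrightarrow> (\<And>x. f x \<noteq> 0) \<Longrightarrow> diff_times n (\<lambda>x. inverse (f x))"
proof (induction n)
  case (Suc n)
  note D = diff_times_Suc_DERIV[OF Suc.prems(1)]
  have I: "diff_times n (\<lambda>x. inverse (f x))"
    using Suc by (auto intro: diff_times_SucD)
  have "((\<lambda>x. inverse (f x)) has_real_derivative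
          (-1) * (inverse (f x) * (deriv f x * inverse (f x)))) (at x)" for x
    using DERIV_inverse'[OF D, of x] Suc.prems(2)[of x] by (simp add: mult.assoc)
  then show ?case
    by (rule diff_times_SucI)
      (intro diff_times_mult diff_times_const I, use Suc.prems in \<open>simp add: diff_times_Suc\<close>)
qed simp

lemma diff_times_comp:
  "diff_times n f \<Longrightarrow> diff_times n g \<Longrightarrow> diff_times n (f \<circ> g)"
proof (induction n arbitrary: f g)
  case (Suc n)
  note D = diff_times_Suc_DERIV[OF Suc.prems(1)] diff_times_Suc_DERIV[OF Suc.prems(2)]
  have "((f \<circ> g) has_real_derivative (deriv f \<circ> g) x * deriv g x) (at x)" for x
    using DERIV_chain[OF D] by simp
  moreover have "diff_times n (\<lambda>x. (deriv f \<circ> g) x * deriv g x)"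
    using Suc.prems by (intro diff_times_mult Suc.IH)
      (auto simp: diff_times_Suc intro: diff_times_SucD[OF Suc.prems(2)])
  ultimately show ?case
    by (rule diff_times_SucI)
qed simp

lemma smooth_DERIV: "smooth f \<Longrightarrow> (f has_real_derivative deriv f x) (at x)"
  using diff_times_Suc_DERIV smooth_iff_diff_times by blast

lemma diffeomorphism_id: "diffeomorphism id"
proof -
  have "smooth id"
    by (simp add: smooth_iff_diff_times diff_times_id)
  moreover have "homeomorphism UNIV UNIV id (id :: real \<Rightarrow> real)"
    by (simp add: homeomorphism_def)
  moreover have "deriv id x \<noteq> 0" for x :: real
    by simp
  ultimately show ?thesis
    unfolding diffeomorphism_def by blast
qed

lemma diffeomorphism_comp:
  assumes "diffeomorphism f" "diffeomorphism g"
  shows "diffeomorphism (f \<circ> g)"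
proof -
  have s: "smooth f" "smooth g"
    using assms by (auto simp: diffeomorphism_def)
  have "smooth (f \<circ> g)"
    using s by (simp add: smooth_iff_diff_times diff_times_comp)
  moreover have "\<exists>k. homeomorphism UNIV UNIV (f \<circ> g) k"
    using assms homeomorphism_compose unfolding diffeomorphism_def by blast
  moreover have "deriv (f \<circ> g) x = deriv f (g x) * deriv g x" for x
    by (intro DERIV_imp_deriv DERIV_chain smooth_DERIV s)
  ultimately show ?thesis
    using assms by (auto simp: diffeomorphism_def)
qed

lemma diffeomorphism_inverse:
  assumes f: "diffeomorphism f" and h: "homeomorphism UNIV UNIV f g"
  shows "diffeomorphism g"
proof -
  have s: "smooth f" and nz: "\<And>x. deriv f x \<noteq> 0"
    using f by (auto simp: diffeomorphism_def)
  have fg: "f (g x) = x" and cont: "continuous (at x) g" for x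
    using h by (auto simp: homeomorphism_def continuous_on_eq_continuous_at)
  have D: "(g has_real_derivative inverse ((deriv f \<circ> g) x)) (at x)" for x
    using DERIV_inverse_function[where f = f and g = g and x = x and a = "x - 1" and b = "x + 1"]
      smooth_DERIV[OF s] nz fg cont by simp
  have "diff_times n g" for n
  proof (induction n)
    case (Suc n)
    have "diff_times n (deriv f)"
      using s diff_times_Suc smooth_iff_diff_times by blast
    from diff_times_comp[OF this Suc] have "diff_times n (\<lambda>x. inverse ((deriv f \<circ> g) x))"
      by (rule diff_times_inverse) (simp add: nz)
    with D show ?case
      by (rule diff_times_SucI)
  qed simp
  then have "smooth g"
    by (simp add: smooth_iff_diff_times)
  moreover have "deriv g x \<noteq> 0" for x
    using DERIV_imp_deriv[OF D] nz by simp
  ultimately show ?thesis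
    using homeomorphism_symD[OF h] by (auto simp: diffeomorphism_def)
qed

lemma Diffeo_inverse_exists:
  assumes "f \<in> carrier Diffeo"
  obtains g where "g \<in> carrier Diffeo" "g \<circ> f = id" "f \<circ> g = id"
proof -
  obtain g where h: "homeomorphism UNIV UNIV f g"
    using assms by (auto simp: Diffeo_def diffeomorphism_def)
  then have "g \<in> carrier Diffeo"
    using assms diffeomorphism_inverse by (auto simp: Diffeo_def)
  moreover have "g \<circ> f = id" "f \<circ> g = id"
    using h by (auto simp: homeomorphism_def fun_eq_iff)
  ultimately show ?thesis
    by (rule that)
qed

lemma group_Diffeo: "group Diffeo"
proof (rule groupI)
  fix f assume "f \<in> carrier Diffeo"
  then show "\<exists>g\<in>carrier Diffeo. g \<otimes>\<^bsub>Diffeo\<^esub> f = \<one>\<^bsub>Diffeo\<^esub>"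
    by (rule Diffeo_inverse_exists) (auto simp: Diffeo_def)
qed (auto simp: Diffeo_def diffeomorphism_id diffeomorphism_comp o_assoc)

lemma inv_Diffeo:
  assumes "f \<in> carrier Diffeo"
  shows "inv\<^bsub>Diffeo\<^esub> f = inv_into UNIV f"
proof -
  interpret group Diffeo by (rule group_Diffeo)
  obtain g where g: "g \<in> carrier Diffeo" "g \<circ> f = id" "f \<circ> g = id"
    using assms by (rule Diffeo_inverse_exists)
  have "inv\<^bsub>Diffeo\<^esub> f = g"
    using g assms by (intro inv_equality) (auto simp: Diffeo_def)
  also have "g = inv_into UNIV f"
    using g inv_unique_comp by metis
  finally show ?thesis .
qed

lemma subgroup_Diffeo_plus: "subgroup (carrier Diffeo_plus) Diffeo"
proof -
  interpret group Diffeo by (rule group_Diffeo)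
  show ?thesis
  proof (rule subgroupI)
    show "carrier Diffeo_plus \<noteq> {}"
      using diffeomorphism_id by (auto simp: Diffeo_plus_def Diffeo_def strict_mono_def intro!: exI[of _ id])
  next
    fix f assume "f \<in> carrier Diffeo_plus"
    then have f: "f \<in> carrier Diffeo" "strict_mono f"
      by (auto simp: Diffeo_plus_def)
    obtain g where g: "g \<in> carrier Diffeo" "g \<circ> f = id" "f \<circ> g = id"
      using f(1) by (rule Diffeo_inverse_exists)
    have "inv\<^bsub>Diffeo\<^esub> f = g"
      using g f by (intro inv_equality) (auto simp: Diffeo_def)
    moreover have "strict_mono g"
      using f(2) g(3) by (metis comp_apply id_apply strict_mono_def strict_mono_less)
    ultimately show "inv\<^bsub>Diffeo\<^esub> f \<in> carrier Diffeo_plus"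
      using g by (simp add: Diffeo_plus_def)
  qed (auto simp: Diffeo_plus_def Diffeo_def diffeomorphism_comp strict_mono_def)
qed

lemma group_Diffeo_plus: "group Diffeo_plus"
proof -
  have "Diffeo_plus = Diffeo\<lparr>carrier := carrier Diffeo_plus\<rparr>"
    by (simp add: Diffeo_plus_def)
  then show ?thesis
    using subgroup.subgroup_is_group[OF subgroup_Diffeo_plus group_Diffeo] by simp
qed

end

theory Submission
  imports Defs
begin

text \<open>The relation \<open>h f h\<^sup>-\<^sup>1 = f\<^sup>-\<^sup>1\<close> is used in the form \<open>f h f = h\<close>; then \<open>f\<close> commutes with
  \<open>h\<^sup>2\<close>. Kopell's lemma says that an increasing diffeomorphism commuting with a one-sided contraction is
  the identity on its domain as soon as it has another fixed point there.

  If \<open>f\<close> is decreasing, \<open>h\<close> may be taken increasing (replace it by \<open>h f\<close>), and it fixes the fixed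
  point of \<open>f\<close>; Kopell's lemma for \<open>h\<^sup>2\<close> and \<open>f\<^sup>2\<close> gives \<open>f\<^sup>2 = id\<close>.

  If \<open>f\<close> is increasing and \<open>h\<close> decreasing with \<open>h 0 = 0\<close>, a reversing involution is built. When \<open>f\<close>
  has no fixed point, \<open>f\<close> is smoothly conjugate to a translation. Otherwise glue \<open>h\<close> on \<open>[0, \<infinity>)\<close> to
  \<open>h\<^sup>-\<^sup>1\<close> on \<open>(-\<infinity>, 0]\<close>, which is smooth if \<open>h\<^sup>2 - id\<close> is flat at \<open>0\<close>. This is so if \<open>f 0 \<noteq> 0\<close>,
  because Kopell's lemma yields \<open>h\<^sup>2 = id\<close> near \<open>0\<close>, and if \<open>f - id\<close> is not flat at \<open>0\<close>, by a comparison of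
  leading terms. If \<open>f - id\<close> is flat but \<open>h\<^sup>2 - id\<close> is not, then \<open>f = id\<close> near \<open>0\<close>, where the glued
  map can be modified freely.\<close>

text \<open>HOL-Algebra claims the notation \<open>inv\<close> for group inverses.\<close>

abbreviation finv :: "('a \<Rightarrow> 'b) \<Rightarrow> 'b \<Rightarrow> 'a"
  where "finv f \<equiv> inv_into UNIV f"

section \<open>Smooth functions\<close>

lemma smooth_const: "smooth (\<lambda>_. c)"
  by (simp add: smooth_iff_diff_times diff_times_const)

lemma smooth_ident: "smooth (\<lambda>x. x)"
  using diff_times_id by (simp add: smooth_iff_diff_times id_def)

lemma smooth_add: "smooth f \<Longrightarrow> smooth g \<Longrightarrow> smooth (\<lambda>x. f x + g x)"
  by (simp add: smooth_iff_diff_times diff_times_add)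

lemma smooth_mult: "smooth f \<Longrightarrow> smooth g \<Longrightarrow> smooth (\<lambda>x. f x * g x)"
  by (simp add: smooth_iff_diff_times diff_times_mult)

lemma smooth_inverse: "smooth f \<Longrightarrow> (\<And>x. f x \<noteq> 0) \<Longrightarrow> smooth (\<lambda>x. inverse (f x))"
  by (simp add: smooth_iff_diff_times diff_times_inverse)

lemma smooth_comp: "smooth f \<Longrightarrow> smooth g \<Longrightarrow> smooth (\<lambda>x. f (g x))"
  using diff_times_comp by (simp add: smooth_iff_diff_times o_def)

lemma smooth_minus: "smooth f \<Longrightarrow> smooth (\<lambda>x. - f x)"
  using smooth_mult[OF smooth_const[of "-1"]] by simp

lemma smooth_diff: "smooth f \<Longrightarrow> smooth g \<Longrightarrow> smooth (\<lambda>x. f x - g x)"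
  using smooth_add[OF _ smooth_minus] by simp

lemma smooth_sum: "(\<And>i. i \<in> I \<Longrightarrow> smooth (f i)) \<Longrightarrow> smooth (\<lambda>x. \<Sum>i\<in>I. f i x)"
  by (induction I rule: infinite_finite_induct) (auto intro: smooth_add smooth_const)

lemmas smooth_intros = smooth_const smooth_ident smooth_add smooth_mult smooth_minus smooth_diff
  smooth_sum

lemma smooth_deriv: "smooth f \<Longrightarrow> smooth (deriv f)"
  by (metis smooth_iff_diff_times diff_times_Suc)

lemma smooth_funpow_deriv: "smooth f \<Longrightarrow> smooth ((deriv ^^ n) f)"
  by (induction n) (auto intro: smooth_deriv)

lemma smooth_isCont: "smooth f \<Longrightarrow> isCont f x"
  using DERIV_isCont smooth_DERIV by blast

lemma smooth_continuous_on: "smooth f \<Longrightarrow> continuous_on S f"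
  by (simp add: continuous_at_imp_continuous_on smooth_isCont)

text \<open>Equality with \<open>g\<close> near \<open>x\<close> is equality near every point close
  to \<open>x\<close>, so it passes to all higher derivatives.\<close>

lemma smooth_local:
  assumes "\<And>x. \<exists>g. smooth g \<and> (\<forall>\<^sub>F y in nhds x. f y = g y)"
  shows "smooth f"
  unfolding smooth_def
proof (intro allI)
  fix n x
  obtain g where g: "smooth g" "\<forall>\<^sub>F y in nhds x. f y = g y"
    using assms by blast
  have "\<forall>\<^sub>F y in nhds x. \<forall>\<^sub>F z in nhds y. f z = g z"
    using g(2) by (simp add: eventually_eventually)
  then have "\<forall>\<^sub>F y in nhds x. (deriv ^^ n) f y = (deriv ^^ n) g y"
    by eventually_elim (rule higher_deriv_cong_ev, auto)
  moreover have "((deriv ^^ n) g has_real_derivative deriv ((deriv ^^ n) g) x) (at x)"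
    by (rule smooth_DERIV[OF smooth_funpow_deriv[OF g(1)]])
  ultimately show "(deriv ^^ n) f differentiable (at x)"
    unfolding real_differentiable_def using DERIV_cong_ev[OF refl _ refl] by blast
qed

lemma smooth_mvt:
  fixes x y :: real
  assumes "smooth f"
  obtains z where "min x y \<le> z" "z \<le> max x y" "f y - f x = deriv f z * (y - x)"
proof -
  consider "x = y" | "x < y" | "y < x" by linarith
  then show ?thesis
  proof cases
    case 1 then show ?thesis using that[of x] by simp
  next
    case 2
    from MVT2[OF this smooth_DERIV[OF assms]] obtain z where "x < z" "z < y"
      "f y - f x = (y - x) * deriv f z" by blast
    then show ?thesis using that[of z] by (simp add: mult.commute)
  next
    case 3
    from MVT2[OF this smooth_DERIV[OF assms]] obtain z where "y < z" "z < x"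
      "f x - f y = (x - y) * deriv f z" by blast
    then show ?thesis using that[of z] by (simp add: algebra_simps)
  qed
qed

section \<open>Diffeomorphisms as monotone functions\<close>

lemma diffeomorphism_smooth: "diffeomorphism f \<Longrightarrow> smooth f"
  by (simp add: diffeomorphism_def)

lemma diffeomorphism_bij: "diffeomorphism f \<Longrightarrow> bij f"
  unfolding diffeomorphism_def homeomorphism_def by (metis UNIV_I bij_betw_byWitness subset_UNIV)

lemma diffeomorphism_inv: "diffeomorphism f \<Longrightarrow> diffeomorphism (finv f)"
proof -
  assume f: "diffeomorphism f"
  then obtain g where g: "homeomorphism UNIV UNIV f g"
    by (auto simp: diffeomorphism_def)
  then have "finv f = g"
    by (intro Hilbert_Choice.inv_equality) (auto simp: homeomorphism_def)
  with f g show ?thesis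
    using diffeomorphism_inverse by blast
qed

lemma diffeomorphism_inv_f [simp]: "diffeomorphism f \<Longrightarrow> finv f (f x) = x"
  using diffeomorphism_bij bij_inv_eq_iff by metis

lemma diffeomorphism_f_inv [simp]: "diffeomorphism f \<Longrightarrow> f (finv f x) = x"
  using diffeomorphism_bij bij_inv_eq_iff by metis

lemma diffeomorphism_comp': "diffeomorphism f \<Longrightarrow> diffeomorphism g \<Longrightarrow> diffeomorphism (\<lambda>x. f (g x))"
  using diffeomorphism_comp by (simp add: o_def)

lemma diffeomorphism_deriv_nonzero: "diffeomorphism f \<Longrightarrow> deriv f x \<noteq> 0"
  by (simp add: diffeomorphism_def)

text \<open>The derivative is continuous without zeros, so by the intermediate value theorem it
  keeps one sign.\<close>

lemma diffeomorphism_mono_cases: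
  assumes "diffeomorphism f"
  obtains (inc) "strict_mono f" "\<And>x. deriv f x > 0"
  | (dec) "strict_antimono_on UNIV f" "\<And>x. deriv f x < 0"
proof (cases "\<exists>a. deriv f a > 0")
  case True
  then obtain a where a: "deriv f a > 0" ..
  note s = diffeomorphism_smooth[OF assms]
  have c: "continuous_on S (deriv f)" for S
    by (intro smooth_continuous_on smooth_deriv s)
  have pos: "deriv f x > 0" for x
  proof (rule ccontr)
    assume "\<not> deriv f x > 0"
    then have "\<exists>z. deriv f z = 0"
      using IVT'[of "deriv f" x 0 a, OF _ _ _ c] IVT2'[of "deriv f" x 0 a, OF _ _ _ c] a
      by (cases "x \<le> a") auto
    then show False
      using diffeomorphism_deriv_nonzero[OF assms] by blast
  qed
  have "strict_mono f"
    using DERIV_pos_imp_increasing pos smooth_DERIV[OF s] by (metis strict_mono_def)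
  then show ?thesis using pos inc by blast
next
  case False
  note s = diffeomorphism_smooth[OF assms]
  have neg: "deriv f x < 0" for x
    using False diffeomorphism_deriv_nonzero[OF assms, of x] by (metis
        linorder_neqE_linordered_idom)
  have "strict_antimono_on UNIV f"
    using DERIV_neg_imp_decreasing neg smooth_DERIV[OF s] unfolding monotone_def by metis
  then show ?thesis using neg dec by blast
qed

lemma strict_mono_inv_diffeomorphism:
  assumes "diffeomorphism f" "strict_mono f"
  shows "strict_mono (finv f)"
proof (rule strict_monoI)
  fix x y :: real assume "x < y"
  then have "f (finv f x) < f (finv f y)"
    using assms(1) by simp
  then show "finv f x < finv f y"
    using strict_mono_less[OF assms(2)] by blast
qed

lemma diffeomorphism_deriv_pos:
  assumes "diffeomorphism f" "strict_mono f"
  shows "deriv f x > 0"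
  using assms(1)
proof (cases rule: diffeomorphism_mono_cases)
  case dec
  then show ?thesis
    using assms(2) unfolding strict_mono_def monotone_def by (meson less_asym lt_ex)
qed

lemma diffeomorphism_deriv_neg:
  assumes "diffeomorphism f" "strict_antimono_on UNIV f"
  shows "deriv f x < 0"
  using assms(1)
proof (cases rule: diffeomorphism_mono_cases)
  case inc
  then show ?thesis
    using assms(2) unfolding strict_mono_def monotone_def by (meson less_asym lt_ex)
qed

lemma strict_antimono_inv_diffeomorphism:
  assumes "diffeomorphism f" "strict_antimono_on UNIV f"
  shows "strict_antimono_on UNIV (finv f)"
proof (rule monotoneI)
  fix x y :: real assume "x < y"
  then have *: "f (finv f x) < f (finv f y)"
    using assms(1) by simp
  show "finv f y < finv f x"
  proof (rule ccontr)
    assume "\<not> finv f y < finv f x"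
    then consider "finv f x = finv f y" | "finv f x < finv f y" by linarith
    then show False
      using * monotoneD[OF assms(2), of "finv f x" "finv f y"] by cases auto
  qed
qed

lemma diffeomorphismI:
  assumes s: "smooth f" and d: "\<And>x. deriv f x > 0" and "surj f"
  shows "diffeomorphism f"
proof -
  have "strict_mono f"
    using DERIV_pos_imp_increasing d smooth_DERIV[OF s] by (metis strict_mono_def)
  then have "inj f"
    by (rule strict_mono_imp_inj_on)
  then have "\<exists>g. homeomorphism UNIV UNIV f g"
    using homeomorphism_into_1d[of UNIV f UNIV] assms smooth_continuous_on by auto
  then show ?thesis
    using s d by (auto simp: diffeomorphism_def less_le)
qed

lemma diffeomorphism_involution:
  assumes s: "smooth t" and t: "\<And>x. t (t x) = x"
  shows "diffeomorphism t"
proof -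
  have "homeomorphism UNIV UNIV t t"
    using t smooth_continuous_on[OF s] by (auto simp: homeomorphism_def) (metis rangeI)+
  moreover have "deriv t x \<noteq> 0" for x
  proof -
    \<comment> \<open>Differentiating \<open>t (t x) = x\<close> shows that the derivative cannot
      vanish.\<close>
    have "((\<lambda>x. t (t x)) has_real_derivative deriv t (t x) * deriv t x) (at x)"
      by (intro DERIV_chain2 smooth_DERIV s)
    then have "deriv t (t x) * deriv t x = 1"
      using t DERIV_unique[OF _ DERIV_ident] by simp
    then show ?thesis by auto
  qed
  ultimately show ?thesis using s by (auto simp: diffeomorphism_def)
qed

lemma diffeomorphism_funpow: "diffeomorphism f \<Longrightarrow> diffeomorphism (f ^^ n)"
  by (induction n) (auto intro: diffeomorphism_comp diffeomorphism_id simp: id_def[symmetric])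

lemma strict_mono_funpow: "strict_mono (f :: real \<Rightarrow> real) \<Longrightarrow> strict_mono (f ^^ n)"
  by (induction n) (auto simp: strict_mono_def)

lemma funpow_commute:
  assumes "\<And>x. f (g x) = g (f x)"
  shows "(f ^^ n) (g x) = g ((f ^^ n) x)"
  by (induction n) (auto simp: assms)

lemma funpow_fixed: "f x = x \<Longrightarrow> (f ^^ n) x = x"
  by (induction n) auto

section \<open>Kopell's lemma\<close>

lemma IVT_sign_change:
  fixes f :: "real \<Rightarrow> real"
  assumes "continuous_on UNIV f" "a \<le> b" "f a \<le> 0 \<and> 0 \<le> f b \<or> f b \<le> 0 \<and> 0 \<le> f a"
  obtains x where "a \<le> x" "x \<le> b" "f x = 0"
  using assms IVT'[of f a 0 b] IVT2'[of f b 0 a] continuous_on_subset[OF assms(1) subset_UNIV]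
  by metis

text \<open>The set of fixed points in \<open>[p0, c]\<close> is closed, so it has a largest element
  \<open>p\<close>; a sign change of \<open>f x - x\<close> right of \<open>p\<close> would produce
  a larger one. On \<open>(p, c]\<close> the map is then the one-sided contraction that Kopell's
  lemma asks for.\<close>

lemma greatest_fixed_point_below:
  fixes f :: "real \<Rightarrow> real"
  assumes cont: "continuous_on UNIV f" and p0: "f p0 = p0" "p0 \<le> c" and c: "f c < c"
  obtains p where "p0 \<le> p" "p < c" "f p = p" "\<And>x. p < x \<Longrightarrow> x \<le> c \<Longrightarrow> f x < x"
proof -
  define S where "S = {x \<in> {p0..c}. f x - x = 0}"
  have "S = {p0..c} \<inter> (\<lambda>x. f x - x) -` {0}"
    by (auto simp: S_def)
  then have "closed S"
    using continuous_on_subset[OF cont subset_UNIV]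
    by (auto intro!: continuous_closed_preimage continuous_intros)
  moreover have ne: "S \<noteq> {}" "bdd_above S"
    using p0 by (auto simp: S_def bdd_above_def)
  ultimately have "Sup S \<in> S"
    using closed_contains_Sup by blast
  then have p: "p0 \<le> Sup S" "Sup S \<le> c" "f (Sup S) = Sup S"
    by (auto simp: S_def)
  have "f x < x" if x: "Sup S < x" "x \<le> c" for x
  proof (rule ccontr)
    assume "\<not> f x < x"
    then have "0 \<le> f x - x" "f c - c \<le> 0"
      using c by auto
    moreover have "continuous_on UNIV (\<lambda>x. f x - x)"
      by (intro continuous_intros cont)
    ultimately obtain y where "x \<le> y" "y \<le> c" "f y - y = 0"
      using IVT_sign_change[of "\<lambda>x. f x - x" x c] x by blast
    then have "y \<in> S"
      using x p by (auto simp: S_def)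
    then show False
      using cSup_upper[OF _ ne(2)] x \<open>x \<le> y\<close> by force
  qed
  then show ?thesis
    using that[of "Sup S"] p c by (metis less_eq_real_def less_irrefl)
qed

lemma funpow_contraction_bounds:
  fixes F :: "real \<Rightarrow> real"
  assumes "strict_mono F" "F p = p" "\<And>x. p < x \<Longrightarrow> x \<le> c \<Longrightarrow> F x < x" "p < x" "x \<le> c"
  shows "p < (F ^^ n) x \<and> (F ^^ n) x \<le> x \<and> (F ^^ Suc n) x < (F ^^ n) x"
proof (induction n)
  case 0
  then show ?case using assms by simp
next
  case (Suc n)
  have "F p < F ((F ^^ n) x)"
    using Suc assms(1) by (simp add: strict_mono_def)
  then show ?case
    using Suc assms by simp
qed

text \<open>The orbit decreases to a limit in \<open>[p, c]\<close>, which is fixed by continuity,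
  and \<open>p\<close> is the only fixed point there.\<close>

lemma funpow_contraction_tendsto:
  fixes F :: "real \<Rightarrow> real"
  assumes "strict_mono F" "continuous_on UNIV F" "F p = p"
    "\<And>x. p < x \<Longrightarrow> x \<le> c \<Longrightarrow> F x < x" "p \<le> x" "x \<le> c"
  shows "(\<lambda>n. (F ^^ n) x) \<longlonglongrightarrow> p"
proof (cases "x = p")
  case True
  then show ?thesis using assms(3) by (simp add: funpow_fixed)
next
  case False
  then have x: "p < x" using assms by simp
  note b = funpow_contraction_bounds[OF assms(1,3,4) x assms(6)]
  have "decseq (\<lambda>n. (F ^^ n) x)"
    using b by (intro decseq_SucI) (simp add: less_imp_le)
  moreover have "\<forall>n. p \<le> (F ^^ n) x"
    using b less_imp_le by blast
  ultimately obtain L where L: "(\<lambda>n. (F ^^ n) x) \<longlonglongrightarrow> L" "\<forall>n. L \<le> (F ^^ n) x"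
    using decseq_convergent by blast
  have "(\<lambda>n. F ((F ^^ n) x)) \<longlonglongrightarrow> F L"
    using L(1) assms(2) isCont_tendsto_compose[of L F]
    by (simp add: continuous_on_eq_continuous_at)
  moreover have "(\<lambda>n. F ((F ^^ n) x)) \<longlonglongrightarrow> L"
    using LIMSEQ_Suc[OF L(1)] by simp
  ultimately have "F L = L"
    by (rule LIMSEQ_unique)
  moreover have "p \<le> L"
    using LIMSEQ_le_const[OF L(1)] b less_imp_le by blast
  moreover have "L \<le> c"
    using L(2)[rule_format, of 0] assms by simp
  ultimately have "L = p"
    using assms(4)[of L] by force
  then show ?thesis using L by simp
qed

section \<open>Distortion of iterates\<close>

lemma deriv_funpow:
  assumes "smooth F"
  shows "((F ^^ n) has_real_derivative (\<Prod>i<n. deriv F ((F ^^ i) x))) (at x)"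
proof (induction n)
  case (Suc n)
  have "((\<lambda>x. F ((F ^^ n) x)) has_real_derivative
      deriv F ((F ^^ n) x) * (\<Prod>i<n. deriv F ((F ^^ i) x))) (at x)"
    by (rule DERIV_chain2[OF smooth_DERIV[OF assms] Suc])
  then show ?case by (simp add: o_def mult.commute)
qed (auto simp: id_def)

text \<open>The derivative of \<open>ln f\<close> is bounded on a compact interval. The lemma is
  meant for \<open>deriv F\<close>, whose logarithm turns the chain rule product for iterates into a
  sum.\<close>

lemma smooth_pos_ln_Lipschitz:
  assumes "smooth f" "\<And>x. f x > 0"
  obtains L where "L \<ge> 0"
    "\<And>x y. x \<in> {p..c} \<Longrightarrow> y \<in> {p..c} \<Longrightarrow> \<bar>ln (f x) - ln (f y)\<bar> \<le> L * \<bar>x - y\<bar>"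
proof -
  define g where "g = (\<lambda>x. deriv f x / f x)"
  have D: "((\<lambda>x. ln (f x)) has_real_derivative g x) (at x)" for x
    using smooth_DERIV[OF assms(1)] assms(2)
    by (auto intro!: derivative_eq_intros simp: g_def field_simps)
  have "continuous_on {p..c} g"
    unfolding g_def using assms(2)
    by (intro continuous_intros smooth_continuous_on smooth_deriv assms(1)) (metis less_irrefl)
  then have "bounded (g ` {p..c})"
    by (intro compact_imp_bounded compact_continuous_image) auto
  then obtain L where L: "\<forall>x\<in>{p..c}. \<bar>g x\<bar> \<le> L" "L > 0"
    unfolding bounded_pos real_norm_def by blast
  have "\<bar>ln (f x) - ln (f y)\<bar> \<le> L * \<bar>x - y\<bar>" if "x \<in> {p..c}" "y \<in> {p..c}" for x y
    using field_differentiable_bound[of "{p..c}" "\<lambda>x. ln (f x)" g L x y,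
        OF _ has_field_derivative_at_within[OF D]] that L
    by auto
  then show ?thesis using that[of L] L by auto
qed

text \<open>The orbit of a fundamental interval \<open>[F z, z]\<close> consists of non-overlapping intervals, so the
  logarithmic distortions of the iterates add up to at most a constant times the length \<open>z - p\<close>.\<close>

lemma bounded_distortion:
  assumes F: "diffeomorphism F" "strict_mono F" and p: "F p = p"
    and contr: "\<And>x. p < x \<Longrightarrow> x \<le> z \<Longrightarrow> F x < x" and z: "p < z"
  obtains C where "C > 0"
    "\<And>n x y. x \<in> {F z..z} \<Longrightarrow> y \<in> {F z..z} \<Longrightarrow> deriv (F ^^ n) x \<le> C * deriv (F ^^ n) y"
proof -
  note s = diffeomorphism_smooth[OF F(1)]
  note pos = diffeomorphism_deriv_pos[OF F]
  obtain L where L: "L \<ge> 0"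
    "\<And>x y. x \<in> {p..z} \<Longrightarrow> y \<in> {p..z} \<Longrightarrow>
      \<bar>ln (deriv F x) - ln (deriv F y)\<bar> \<le> L * \<bar>x - y\<bar>"
    using smooth_pos_ln_Lipschitz[OF smooth_deriv[OF s] pos, of p z] by blast
  note b = funpow_contraction_bounds[OF F(2) p contr z order.refl]
  have D: "deriv (F ^^ n) x = (\<Prod>i<n. deriv F ((F ^^ i) x))" for n x
    using DERIV_imp_deriv[OF deriv_funpow[OF s]] .
  have "deriv (F ^^ n) x \<le> exp (L * (z - p)) * deriv (F ^^ n) y"
    if "x \<in> {F z..z}" "y \<in> {F z..z}" for n x y
  proof -
    have range: "(F ^^ i) w \<in> {(F ^^ Suc i) z..(F ^^ i) z}" if "w \<in> {F z..z}" for i w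
    proof -
      have "(F ^^ i) (F z) \<le> (F ^^ i) w" "(F ^^ i) w \<le> (F ^^ i) z"
        using that strict_mono_less_eq[OF strict_mono_funpow[OF F(2)]] by auto
      then show ?thesis by (simp add: funpow_swap1)
    qed
    have "ln (deriv F ((F ^^ i) x)) - ln (deriv F ((F ^^ i) y))
        \<le> L * ((F ^^ i) z - (F ^^ Suc i) z)" for i
    proof -
      have "(F ^^ i) x \<in> {p..z}" "(F ^^ i) y \<in> {p..z}"
        using range[OF that(1), of i] range[OF that(2), of i] b[of i] b[of "Suc i"] by auto
      then have "ln (deriv F ((F ^^ i) x)) - ln (deriv F ((F ^^ i) y))
          \<le> L * \<bar>(F ^^ i) x - (F ^^ i) y\<bar>"
        using L(2) by (smt (verit))
      also have "\<dots> \<le> L * ((F ^^ i) z - (F ^^ Suc i) z)"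
        using range[OF that(1), of i] range[OF that(2), of i] L(1) by (intro mult_left_mono) auto
      finally show ?thesis .
    qed
    then have "(\<Sum>i<n. ln (deriv F ((F ^^ i) x)) - ln (deriv F ((F ^^ i) y)))
        \<le> (\<Sum>i<n. L * ((F ^^ i) z - (F ^^ Suc i) z))"
      by (intro sum_mono)
    also have "\<dots> = L * (z - (F ^^ n) z)"
      unfolding sum_distrib_left[symmetric] by (subst sum_lessThan_telescope') simp
    also have "\<dots> \<le> L * (z - p)"
      using b[of n] L(1) by (intro mult_left_mono) auto
    finally have "ln (deriv (F ^^ n) x) - ln (deriv (F ^^ n) y) \<le> L * (z - p)"
      unfolding D using pos by (simp add: ln_prod sum_subtractf less_imp_neq[THEN not_sym])
    then have "exp (ln (deriv (F ^^ n) x)) \<le> exp (L * (z - p) + ln (deriv (F ^^ n) y))"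
      by simp
    moreover have "deriv (F ^^ n) w > 0" for w
      unfolding D using pos by (simp add: prod_pos)
    ultimately show ?thesis
      by (simp add: exp_add)
  qed
  then show ?thesis using that[of "exp (L * (z - p))"] by simp
qed

text \<open>Along \<open>X\<close> every difference quotient equals \<open>1\<close>.\<close>

lemma deriv_eq_1_if_fixed_points_accumulate:
  assumes "(G has_real_derivative D) (at p)" "G p = p"
    "X \<longlonglongrightarrow> p" "\<And>n. X n \<noteq> p" "\<And>n::nat. G (X n) = X n"
  shows "D = 1"
proof -
  have "((\<lambda>y. (G y - G p) / (y - p)) \<longlongrightarrow> D) (at p)"
    using assms(1) by (simp add: has_field_derivative_iff)
  moreover have "filterlim X (at p) sequentially"
    using assms(3,4) by (simp add: filterlim_at)
  ultimately have "(\<lambda>n. (G (X n) - G p) / (X n - p)) \<longlonglongrightarrow> D"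
    by (rule filterlim_compose)
  then show ?thesis
    using assms by (simp add: LIMSEQ_const_iff)
qed

text \<open>The mean value theorem on both sides of
  \<open>F^n (G y) - F^n u = G (F^n y) - G (F^n u)\<close> compares
  \<open>(F^n)'(a) (G y - u)\<close> with \<open>G'(w) (F^n)'(b) (y - u)\<close>. Distortion bounds
  the ratio of the derivatives of \<open>F^n\<close> by \<open>C\<close>, and \<open>w\<close> tends
  to \<open>p\<close>, where \<open>G' = 1\<close>. As \<open>C\<close> depends on \<open>F\<close>
  and \<open>z\<close> only, the estimate serves all powers of a commuting map at once.\<close>

lemma commuting_Lipschitz:
  assumes F: "diffeomorphism F" "strict_mono F" and p: "F p = p"
    and contr: "\<And>x. p < x \<Longrightarrow> x \<le> z \<Longrightarrow> F x < x" and z: "p < z"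
  obtains C where "C > 0"
    "\<And>G u y. \<lbrakk>smooth G; strict_mono G; \<And>x. F (G x) = G (F x); G z = z; G u = u;
      F z \<le> u; u \<le> y; y \<le> z\<rbrakk> \<Longrightarrow> G y - u \<le> C * (y - u)"
proof -
  obtain C where C: "C > 0"
    "\<And>n x y. x \<in> {F z..z} \<Longrightarrow> y \<in> {F z..z} \<Longrightarrow> deriv (F ^^ n) x \<le> C * deriv (F ^^ n) y"
    using bounded_distortion[OF F p contr z] by blast
  have "G y - u \<le> C * (y - u)" if G: "smooth G" "strict_mono G" "\<And>x. F (G x) = G (F x)"
      "G z = z" "G u = u" "F z \<le> u" "u \<le> y" "y \<le> z" for G u y
  proof -
    note cont = smooth_continuous_on[OF diffeomorphism_smooth[OF F(1)]]
    have comm: "(F ^^ n) (G x) = G ((F ^^ n) x)" for n x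
      by (rule funpow_commute) (rule G(3))
    have sF: "smooth (F ^^ n)" for n
      using F(1) diffeomorphism_smooth diffeomorphism_funpow by blast
    have pFz: "p < F z"
      using funpow_contraction_bounds[OF F(2) p contr z order.refl, of 1] by simp
    have Gy: "u \<le> G y" "G y \<le> z"
      using G strict_mono_less_eq[OF G(2)] by metis+
    \<comment> \<open>The points \<open>F^n z\<close> are fixed by \<open>G\<close> and accumulate
      at \<open>p\<close>.\<close>
    have G': "deriv G p = 1"
    proof (rule deriv_eq_1_if_fixed_points_accumulate[OF smooth_DERIV[OF G(1)]])
      show X: "(\<lambda>n. (F ^^ n) z) \<longlonglongrightarrow> p"
        using funpow_contraction_tendsto[OF F(2) cont p contr] z by simp
      show "(F ^^ n) z \<noteq> p" for n
        using funpow_contraction_bounds[OF F(2) p contr z order.refl, of n] by auto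
      show GX: "G ((F ^^ n) z) = (F ^^ n) z" for n
        using comm[of n z] G(4) by simp
      have "(\<lambda>n. G ((F ^^ n) z)) \<longlonglongrightarrow> G p"
        by (rule isCont_tendsto_compose[OF smooth_isCont[OF G(1)] X])
      then show "G p = p"
        using X LIMSEQ_unique by (simp add: GX)
    qed
    have "\<exists>w. (F ^^ n) u \<le> w \<and> w \<le> (F ^^ n) y \<and> G y - u \<le> C * deriv G w * (y - u)" if "u < y" for n
    proof -
      obtain w where w: "min ((F ^^ n) u) ((F ^^ n) y) \<le> w" "w \<le> max ((F ^^ n) u) ((F ^^ n) y)"
        "G ((F ^^ n) y) - G ((F ^^ n) u) = deriv G w * ((F ^^ n) y - (F ^^ n) u)"
        using smooth_mvt[OF G(1)] by blast
      obtain a where a: "min u (G y) \<le> a" "a \<le> max u (G y)"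
        "(F ^^ n) (G y) - (F ^^ n) u = deriv (F ^^ n) a * (G y - u)"
        using smooth_mvt[OF sF] by blast
      obtain b where b: "min u y \<le> b" "b \<le> max u y"
        "(F ^^ n) y - (F ^^ n) u = deriv (F ^^ n) b * (y - u)"
        using smooth_mvt[OF sF] by blast
      have le: "(F ^^ n) u \<le> (F ^^ n) y"
        using strict_mono_less_eq[OF strict_mono_funpow[OF F(2)]] G by blast
      have Dpos: "deriv (F ^^ n) x > 0" for x
        using diffeomorphism_deriv_pos diffeomorphism_funpow strict_mono_funpow F by blast
      have "G ((F ^^ n) u) = (F ^^ n) u"
        using comm[of n u] G(5) by simp
      with w(3) a(3) b(3) have eq: "deriv (F ^^ n) a * (G y - u) = deriv G w * (deriv (F ^^ n) b *
          (y - u))"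
        by (simp add: comm)
      have "deriv (F ^^ n) b \<le> C * deriv (F ^^ n) a"
        using a b G Gy by (intro C(2)) auto
      \<comment> \<open>In \<open>eq\<close> the factor multiplying \<open>deriv G w\<close> is
        positive and the left side is nonnegative.\<close>
      moreover have "deriv G w \<ge> 0"
      proof -
        have "deriv (F ^^ n) b * (y - u) > 0"
          using Dpos that(1) by simp
        moreover have "deriv (F ^^ n) a * (G y - u) \<ge> 0"
          using Dpos[of a] Gy by simp
        ultimately show ?thesis
          using eq by (metis zero_le_mult_iff not_less)
      qed
      ultimately have "deriv G w * (deriv (F ^^ n) b * (y - u)) \<le> deriv G w * (C * deriv (F ^^ n)
          a * (y - u))"
        using G by (intro mult_left_mono mult_right_mono) auto
      then have "deriv (F ^^ n) a * (G y - u) \<le> deriv (F ^^ n) a * (C * deriv G w * (y - u))"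
        unfolding eq by (simp add: mult_ac)
      then have "G y - u \<le> C * deriv G w * (y - u)"
        using Dpos[of a] by simp
      then show ?thesis using w le by auto
    qed
    then have "\<exists>w. (F ^^ n) u \<le> w \<and> w \<le> (F ^^ n) y \<and> G y - u \<le> C * deriv G w * (y - u)" for n
      using G(5,7) by (cases "u = y") auto
    then obtain w where w: "\<And>n. (F ^^ n) u \<le> w n" "\<And>n. w n \<le> (F ^^ n) y"
      "\<And>n. G y - u \<le> C * deriv G (w n) * (y - u)"
      by metis
    have "w \<longlonglongrightarrow> p"
    proof (rule tendsto_sandwich)
      show "(\<lambda>n. (F ^^ n) u) \<longlonglongrightarrow> p" "(\<lambda>n. (F ^^ n) y) \<longlonglongrightarrow> p"
        using funpow_contraction_tendsto[OF F(2) cont p contr] G pFz by auto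
    qed (use w in auto)
    then have "(\<lambda>n. deriv G (w n)) \<longlonglongrightarrow> deriv G p"
      by (rule isCont_tendsto_compose[OF smooth_isCont[OF smooth_deriv[OF G(1)]]])
    then have "(\<lambda>n. C * deriv G (w n) * (y - u)) \<longlonglongrightarrow> C * deriv G p * (y - u)"
      by (intro tendsto_intros)
    then show ?thesis
      using LIMSEQ_le_const[of _ _ "G y - u"] w(3) G' by force
  qed
  then show ?thesis using that C(1) by blast
qed

text \<open>If \<open>g y > y\<close>, the inverse \<open>k\<close> of \<open>g\<close> contracts
  \<open>(u, y]\<close> towards a fixed point \<open>u\<close>. The uniform estimate for
  \<open>g^m\<close> at the point \<open>k^m y\<close> reads
  \<open>y - u \<le> C (k^m y - u)\<close>, and the right side tends to \<open>0\<close>.\<close>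

lemma Kopell_fundamental_domain:
  assumes F: "diffeomorphism F" "strict_mono F" and p: "F p = p"
    and contr: "\<And>x. p < x \<Longrightarrow> x \<le> z \<Longrightarrow> F x < x" and z: "p < z"
    and g: "diffeomorphism g" "strict_mono g" and comm: "\<And>x. F (g x) = g (F x)"
    and gz: "g z = z" and y: "F z \<le> y" "y \<le> z"
  shows "g y \<le> y"
proof (rule ccontr)
  assume "\<not> g y \<le> y"
  then have gy: "y < g y" by simp
  define k where "k = finv g"
  have k: "diffeomorphism k" "strict_mono k"
    using g diffeomorphism_inv strict_mono_inv_diffeomorphism by (auto simp: k_def)
  have gk [simp]: "g (k x) = x" "k (g x) = x" for x
    using g by (auto simp: k_def)
  have contk: "continuous_on UNIV k"
    by (intro smooth_continuous_on diffeomorphism_smooth k)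
  have gFz: "g (F z) = F z"
    using comm[of z] gz by simp
  have "k y < y"
    using gy strict_mono_less[OF g(2)] gk(1) by metis
  \<comment> \<open>\<open>F z\<close> is a fixed point of \<open>k\<close> too, so \<open>u\<close>
    does not leave the fundamental interval \<open>[F z, z]\<close>.\<close>
  moreover have "k (F z) = F z"
    using gFz gk by metis
  ultimately obtain u where u: "F z \<le> u" "u < y" "k u = u" "\<And>x. u < x \<Longrightarrow> x \<le> y \<Longrightarrow> k x < x"
    using greatest_fixed_point_below[OF contk _ y(1)] by blast
  obtain C where C: "C > 0"
    "\<And>G u y. \<lbrakk>smooth G; strict_mono G; \<And>x. F (G x) = G (F x); G z = z; G u = u;
      F z \<le> u; u \<le> y; y \<le> z\<rbrakk> \<Longrightarrow> G y - u \<le> C * (y - u)"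
    using commuting_Lipschitz[OF F p contr z] by blast
  have "y - u \<le> C * ((k ^^ m) y - u)" for m
  proof -
    have km: "u < (k ^^ m) y" "(k ^^ m) y \<le> y"
      using funpow_contraction_bounds[OF k(2) u(3,4,2) order.refl] by auto
    have "g u = u"
      using u(3) gk by metis
    moreover have "F ((g ^^ m) x) = (g ^^ m) (F x)" for x
      by (rule funpow_commute[symmetric]) (simp add: comm)
    moreover have "(g ^^ m) ((k ^^ m) y) = y"
    proof (induction m)
      case (Suc m)
      have "(g ^^ Suc m) ((k ^^ Suc m) y) = (g ^^ m) (g (k ((k ^^ m) y)))"
        by (simp add: funpow_swap1)
      with Suc show ?case by simp
    qed simp
    ultimately show ?thesis
      using C(2)[of "g ^^ m" u "(k ^^ m) y"] km u y gz diffeomorphism_smooth[OF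
          diffeomorphism_funpow[OF g(1)]]
        strict_mono_funpow[OF g(2)] funpow_fixed[of g] by auto
  qed
  moreover have "(\<lambda>m. C * ((k ^^ m) y - u)) \<longlonglongrightarrow> C * (u - u)"
    using funpow_contraction_tendsto[OF k(2) contk u(3,4), of y y] u(2) by (intro tendsto_intros)
        auto
  ultimately show False
    using LIMSEQ_le_const[of _ _ "y - u"] u(2) by force
qed

text \<open>On \<open>[F z, z]\<close> the previous lemma for \<open>g\<close> and its inverse gives
  the identity; all \<open>F^m z\<close> are fixed points of \<open>g\<close>, so this extends to
  \<open>(p, z]\<close>. Every point of \<open>(p, c]\<close> enters \<open>(p, z)\<close> under
  iteration of \<open>F\<close>, and injectivity of \<open>F^n\<close> carries the equation back. At
  \<open>p\<close> continuity is used.\<close>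

lemma Kopell:
  assumes F: "diffeomorphism F" "strict_mono F" and p: "F p = p"
    and contr: "\<And>x. p < x \<Longrightarrow> x \<le> c \<Longrightarrow> F x < x"
    and g: "diffeomorphism g" "strict_mono g" and comm: "\<And>x. F (g x) = g (F x)"
    and z: "g z = z" "p < z" "z \<le> c" and x: "p \<le> x" "x \<le> c"
  shows "g x = x"
proof -
  note cont = smooth_continuous_on[OF diffeomorphism_smooth[OF F(1)]]
  have b: "p < (F ^^ n) x \<and> (F ^^ n) x \<le> x" if "p < x" "x \<le> c" for n x
    using funpow_contraction_bounds[OF F(2) p contr that] by blast
  have comm': "(F ^^ n) (g x) = g ((F ^^ n) x)" for n x
    by (rule funpow_commute) (rule comm)
  have dom: "g y = y" if zy: "g z = z" "p < z" "z \<le> c" "F z \<le> y" "y \<le> z" for z y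
  proof -
    define k where "k = finv g"
    have k: "diffeomorphism k" "strict_mono k"
      using g diffeomorphism_inv strict_mono_inv_diffeomorphism by (auto simp: k_def)
    have gk [simp]: "g (k x) = x" "k (g x) = x" for x
      using g by (auto simp: k_def)
    have "F (k x) = k (F x)" for x
      by (metis gk comm)
    moreover have "k z = z"
      using zy(1) gk by metis
    ultimately have "k y \<le> y"
      using Kopell_fundamental_domain[OF F p _ zy(2) k _ _ zy(4,5)] contr zy by force
    then have "y \<le> g y"
      using strict_mono_less_eq[OF g(2)] gk by metis
    moreover have "g y \<le> y"
      using Kopell_fundamental_domain[OF F p _ zy(2) g comm zy(1) zy(4,5)] contr zy by force
    ultimately show ?thesis by simp
  qed
  have inner: "g y = y" if y: "p < y" "y \<le> z" for y
  proof -
    have "(\<lambda>n. (F ^^ n) z) \<longlonglongrightarrow> p"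
      using funpow_contraction_tendsto[OF F(2) cont p contr] z by simp
    then have "\<exists>n. (F ^^ n) z < y"
      using order_tendstoD(2)[OF _ y(1)] eventually_sequentially by (metis (mono_tags, lifting)
          order.refl)
    \<comment> \<open>The least such \<open>n\<close> places \<open>y\<close> between
      \<open>F^n z\<close> and \<open>F^(n-1) z\<close>.\<close>
    then obtain n where n: "(F ^^ n) z < y" "\<And>m. m < n \<Longrightarrow> y \<le> (F ^^ m) z"
      using exists_least_iff[of "\<lambda>n. (F ^^ n) z < y"] by (metis not_less)
    then obtain m where m: "n = Suc m"
      using y(2) by (cases n) auto
    have "g ((F ^^ m) z) = (F ^^ m) z"
      using comm'[of m z] z by simp
    moreover have "p < (F ^^ m) z" "(F ^^ m) z \<le> c"
      using b[OF z(2,3), of m] z by auto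
    ultimately show ?thesis
      using dom[of "(F ^^ m) z" y] n m by auto
  qed
  show ?thesis
  proof (cases "x = p")
    case True
    have "(\<lambda>n. (F ^^ n) z) \<longlonglongrightarrow> p"
      using funpow_contraction_tendsto[OF F(2) cont p contr] z by simp
    moreover have "(\<lambda>n. g ((F ^^ n) z)) \<longlonglongrightarrow> g p"
      by (rule isCont_tendsto_compose[OF smooth_isCont[OF diffeomorphism_smooth[OF g(1)]]
          calculation])
    ultimately show ?thesis
      using LIMSEQ_unique True by (simp add: comm'[symmetric] z(1))
  next
    case False
    then have px: "p < x" using x by simp
    have "(\<lambda>n. (F ^^ n) x) \<longlonglongrightarrow> p"
      using funpow_contraction_tendsto[OF F(2) cont p contr] x by simp
    then have "\<exists>n. (F ^^ n) x < z"
      using order_tendstoD(2)[OF _ z(2)] eventually_sequentially by (metis (mono_tags, lifting)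
          order.refl)
    then obtain n where "(F ^^ n) x < z" ..
    then have "g ((F ^^ n) x) = (F ^^ n) x"
      using inner b[OF px x(2), of n] by auto
    then have "(F ^^ n) (g x) = (F ^^ n) x"
      by (simp add: comm')
    then show ?thesis
      using strict_mono_eq[OF strict_mono_funpow[OF F(2)]] by blast
  qed
qed

section \<open>Flat functions and leading terms\<close>

text \<open>Flatness is taken at the point \<open>0\<close>; the index \<open>j = 0\<close> makes
  the value itself vanish.\<close>

definition flat :: "(real \<Rightarrow> real) \<Rightarrow> bool" where
  "flat w \<longleftrightarrow> (\<forall>j. (deriv ^^ j) w 0 = 0)"

lemma flat_deriv: "flat w \<Longrightarrow> flat (deriv w)"
  unfolding flat_def by (metis funpow_Suc_right comp_apply)

text \<open>Induction on the order: the derivative of the glued function is the glued derivative,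
  and \<open>deriv w\<close> is flat again. At \<open>0\<close> the difference quotient is dominated
  by that of \<open>w\<close>.\<close>

lemma smooth_glue_zero:
  assumes "smooth w" "flat w"
  shows "smooth (\<lambda>x. if 0 \<le> x then w x else 0)"
proof -
  have "diff_times n (\<lambda>x. if 0 \<le> x then w x else 0)" if "smooth w" "flat w" for n w
    using that
  proof (induction n arbitrary: w)
    case (Suc n)
    let ?W = "\<lambda>x. if 0 \<le> x then w x else 0"
    have w0: "w 0 = 0" "deriv w 0 = 0"
      using Suc.prems(2) unfolding flat_def by (metis funpow_0, metis funpow_0 funpow_Suc_right
          comp_apply)
    have "(?W has_real_derivative (if 0 \<le> x then deriv w x else 0)) (at x)" for x
    proof -
      consider "x > 0" | "x < 0" | "x = 0" by linarith
      then show ?thesis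
      proof cases
        case 1
        then show ?thesis
          using has_field_derivative_transform_within_open[OF smooth_DERIV[OF Suc.prems(1)], of
              "{0<..}" x ?W]
          by auto
      next
        case 2
        then show ?thesis
          using has_field_derivative_transform_within_open[of "\<lambda>_. 0" 0 x "{..<0}" ?W] by auto
      next
        case 3
        have "((\<lambda>y. (w y - w 0) / (y - 0)) \<longlongrightarrow> 0) (at 0)"
          using smooth_DERIV[OF Suc.prems(1), of 0] w0 by (simp add: has_field_derivative_iff)
        then have A: "((\<lambda>y. \<bar>(w y - w 0) / (y - 0)\<bar>) \<longlongrightarrow> 0) (at 0)"
          by (rule tendsto_rabs_zero)
        have N: "norm ((?W y - ?W 0) / (y - 0)) \<le> \<bar>(w y - w 0) / (y - 0)\<bar>" for y
          by (cases "0 \<le> y") (simp_all add: w0 divide_nonneg_nonpos)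
        have "((\<lambda>y. (?W y - ?W 0) / (y - 0)) \<longlongrightarrow> 0) (at 0)"
          by (rule Lim_null_comparison[OF _ A]) (rule always_eventually[OF allI[OF N]])
        then show ?thesis
          using 3 w0 by (simp add: has_field_derivative_iff)
      qed
    qed
    then show ?case
      by (rule diff_times_SucI) (rule Suc.IH[OF smooth_deriv[OF Suc.prems(1)] flat_deriv[OF
          Suc.prems(2)]])
  qed simp
  with assms show ?thesis
    by (simp add: smooth_iff_diff_times)
qed

text \<open>Taylor's formula with Lagrange remainder leaves only
  \<open>(deriv ^^ p) w t / fact p * x ^ p\<close>, where \<open>t\<close> is no farther from
  \<open>0\<close> than \<open>x\<close>.\<close>

lemma smooth_leading_term:
  assumes "smooth w" "\<And>i. i < p \<Longrightarrow> (deriv ^^ i) w 0 = 0"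
  shows "((\<lambda>x. w x / x ^ p) \<longlongrightarrow> (deriv ^^ p) w 0 / fact p) (at 0)"
proof -
  have "\<exists>t. \<bar>t\<bar> \<le> \<bar>x\<bar> \<and> w x = (deriv ^^ p) w t / fact p * x ^ p" for x
  proof -
    have "\<forall>m x. ((deriv ^^ m) w has_real_derivative (deriv ^^ Suc m) w x) (at x)"
      using smooth_DERIV[OF smooth_funpow_deriv[OF assms(1)]] by simp
    then obtain t where "\<bar>t\<bar> \<le> \<bar>x\<bar>"
      "w x = (\<Sum>m<p. (deriv ^^ m) w 0 / fact m * x ^ m) + (deriv ^^ p) w t / fact p * x ^ p"
      using Maclaurin_all_le[of "\<lambda>m. (deriv ^^ m) w" w x p] by auto
    then show ?thesis using assms(2) by auto
  qed
  then obtain t where t: "\<And>x. \<bar>t x\<bar> \<le> \<bar>x\<bar>" "\<And>x. w x = (deriv ^^ p) w (t x) / fact p * x ^ p"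
    by metis
  have "((\<lambda>x::real. \<bar>x\<bar>) \<longlongrightarrow> 0) (at 0)"
    by (auto intro!: tendsto_eq_intros)
  then have "(t \<longlongrightarrow> 0) (at 0)"
    by (rule Lim_null_comparison[rotated]) (simp add: t(1))
  then have "((\<lambda>x. (deriv ^^ p) w (t x) / fact p) \<longlongrightarrow> (deriv ^^ p) w 0 / fact p) (at 0)"
    by (intro tendsto_intros isCont_tendsto_compose[OF smooth_isCont[OF smooth_funpow_deriv[OF
        assms(1)]]]) auto
  moreover have "(deriv ^^ p) w (t x) / fact p = w x / x ^ p" if "x \<noteq> 0" for x
    using that unfolding t(2)[of x] by simp
  then have "\<forall>\<^sub>F x in at 0. (deriv ^^ p) w (t x) / fact p = w x / x ^ p"
    by (simp add: eventually_at_filter)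
  ultimately show ?thesis
    by (rule Lim_transform_eventually)
qed

lemma flat_tendsto: "smooth w \<Longrightarrow> flat w \<Longrightarrow> ((\<lambda>x. w x / x ^ p) \<longlongrightarrow> 0) (at 0)"
  using smooth_leading_term[of w p] by (simp add: flat_def)

text \<open>\<open>p\<close> is the order of the first nonvanishing derivative at \<open>0\<close>;
  it is positive because \<open>w 0 = 0\<close>. The leading term of \<open>deriv w\<close> is the
  formal derivative of that of \<open>w\<close>.\<close>

lemma nonflat_leading_term:
  assumes "smooth w" "\<not> flat w" "w 0 = 0"
  obtains p a where "p > 0" "a \<noteq> 0" "((\<lambda>x. w x / x ^ p) \<longlongrightarrow> a) (at 0)"
    "((\<lambda>x. deriv w x / x ^ (p - 1)) \<longlongrightarrow> of_nat p * a) (at 0)"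
proof -
  obtain p where p: "(deriv ^^ p) w 0 \<noteq> 0" "\<And>i. i < p \<Longrightarrow> (deriv ^^ i) w 0 = 0"
    using assms(2) exists_least_iff[of "\<lambda>j. (deriv ^^ j) w 0 \<noteq> 0"] unfolding flat_def by blast
  then obtain q where q: "p = Suc q"
    using assms(3) by (cases p) auto
  have sw: "(deriv ^^ i) (deriv w) = (deriv ^^ Suc i) w" for i
    by (simp add: funpow_swap1)
  have "((\<lambda>x. deriv w x / x ^ q) \<longlongrightarrow> (deriv ^^ q) (deriv w) 0 / fact q) (at 0)"
    using p(2) by (intro smooth_leading_term smooth_deriv assms) (simp add: sw q del: funpow.simps)
  also have "(deriv ^^ q) (deriv w) 0 / fact q = of_nat p * ((deriv ^^ p) w 0 / fact p)"
    by (simp add: sw q del: funpow.simps of_nat_Suc)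
  finally show ?thesis
    using that[of p "(deriv ^^ p) w 0 / fact p"] smooth_leading_term[OF assms(1), of p] p q by auto
qed

lemma flatI:
  assumes "smooth w" "\<And>p. ((\<lambda>x. w x / x ^ p) \<longlongrightarrow> 0) (at 0)"
  shows "flat w"
proof (rule ccontr)
  assume "\<not> flat w"
  \<comment> \<open>The hypothesis with \<open>p = 0\<close> says that \<open>w\<close> tends to
    \<open>0\<close>.\<close>
  moreover have "w 0 = 0"
    using assms(2)[of 0] smooth_isCont[OF assms(1), of 0] LIM_unique by (auto simp: isCont_def)
  ultimately obtain p a where "a \<noteq> 0" "((\<lambda>x. w x / x ^ p) \<longlongrightarrow> a) (at 0)"
    using nonflat_leading_term[OF assms(1)] by metis
  with assms(2) show False
    using LIM_unique by blast
qed

section \<open>A smooth step\<close>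

text \<open>The classical flat function \<open>exp (- (1 / x))\<close>, extended by
  \<open>0\<close>; the power in the denominator makes the family closed under differentiation up to
  linear combinations.\<close>

definition exp_inverse :: "nat \<Rightarrow> real \<Rightarrow> real" where
  "exp_inverse m x = (if 0 < x then exp (- (1 / x)) / x ^ m else 0)"

lemma exp_inverse_DERIV:
  "(exp_inverse m has_real_derivative exp_inverse (m + 2) x - of_nat m * exp_inverse (m + 1) x)
      (at x)"
proof -
  have E0: "(exp_inverse m \<longlongrightarrow> 0) (at 0)" for m
  proof (rule filterlim_split_at)
    have "\<forall>\<^sub>F x in at_left 0. 0 = exp_inverse m x"
      by (auto simp: exp_inverse_def eventually_at_filter)
    then show "(exp_inverse m \<longlongrightarrow> 0) (at_left 0)"
      by (rule Lim_transform_eventually[OF tendsto_const])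
    have "((\<lambda>x. inverse x ^ m / exp (inverse x)) \<longlongrightarrow> 0) (at_right (0::real))"
      by (rule filterlim_compose[OF tendsto_power_div_exp_0 filterlim_inverse_at_top_right])
    moreover have "\<forall>\<^sub>F x in at_right 0. inverse x ^ m / exp (inverse x) = exp_inverse m x"
      using eventually_at_right_less
      by eventually_elim (auto simp: exp_inverse_def exp_minus field_simps)
    ultimately show "(exp_inverse m \<longlongrightarrow> 0) (at_right 0)"
      by (rule Lim_transform_eventually)
  qed
  consider "x > 0" | "x < 0" | "x = 0" by linarith
  then show ?thesis
  proof cases
    case 1
    have "((\<lambda>x. exp (- (1 / x)) / x ^ m) has_real_derivative
        exp_inverse (m + 2) x - of_nat m * exp_inverse (m + 1) x) (at x)"
    \<comment> \<open>The power rule yields the exponent \<open>m - 1\<close>, so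
      \<open>m = 0\<close> is treated apart.\<close>
    proof (cases m)
      case 0
      then show ?thesis
        using 1 by (auto intro!: derivative_eq_intros simp: exp_inverse_def power2_eq_square)
    next
      case (Suc k)
      then show ?thesis
        using 1 by (auto intro!: derivative_eq_intros simp: exp_inverse_def simp del: power_Suc)
          (simp add: field_simps power2_eq_square)
    qed
    then show ?thesis
      using has_field_derivative_transform_within_open[of _ _ x "{0<..}" "exp_inverse m"] 1
      by (auto simp: exp_inverse_def)
  next
    case 2
    then show ?thesis
      using has_field_derivative_transform_within_open[of "\<lambda>_. 0" 0 x "{..<0}" "exp_inverse m"]
      by (auto simp: exp_inverse_def)
  next
    case 3
    \<comment> \<open>The difference quotient at \<open>0\<close> is the next member of the
      family.\<close>
    have "\<forall>\<^sub>F y in at 0. exp_inverse (m + 1) y = (exp_inverse m y - exp_inverse m 0) / (y - 0)"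
      using eventually_neq_at_within[of 0]
      by eventually_elim (auto simp: exp_inverse_def)
    then have "((\<lambda>y. (exp_inverse m y - exp_inverse m 0) / (y - 0)) \<longlongrightarrow> 0) (at 0)"
      by (rule Lim_transform_eventually[OF E0])
    then show ?thesis
      using 3 by (simp add: has_field_derivative_iff exp_inverse_def)
  qed
qed

lemma smooth_exp_inverse: "smooth (exp_inverse m)"
proof -
  have "diff_times n (exp_inverse m)" for n m
  proof (induction n arbitrary: m)
    case (Suc n)
    have "diff_times n (\<lambda>x. exp_inverse (m + 2) x + - of_nat m * exp_inverse (m + 1) x)"
      by (intro diff_times_add diff_times_mult diff_times_const Suc.IH)
    then show ?case
      by (intro diff_times_SucI[OF exp_inverse_DERIV]) simp
  qed simp
  then show ?thesis
    by (simp add: smooth_iff_diff_times)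
qed

text \<open>The quotient \<open>E (x - l) / (E (x - l) + E (r - x))\<close> with
  \<open>E = exp_inverse 0\<close>; since \<open>l < r\<close>, at least one summand of the
  denominator is positive.\<close>

lemma smooth_step:
  fixes l r :: real
  assumes "l < r"
  obtains B where "smooth B" "\<And>x. x \<le> l \<Longrightarrow> B x = 0" "\<And>x. r \<le> x \<Longrightarrow> B x = 1"
    "\<And>x. deriv B x \<ge> 0" "\<And>x. l < x \<Longrightarrow> x < r \<Longrightarrow> deriv B x > 0"
proof -
  define E where "E = exp_inverse 0"
  define E' where "E' = exp_inverse 2"
  have sE: "smooth E"
    by (simp add: E_def smooth_exp_inverse)
  have DE: "(E has_real_derivative E' x) (at x)" for x
    using exp_inverse_DERIV[of 0 x] by (simp add: E_def E'_def numeral_2_eq_2)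
  note E_def = E_def exp_inverse_def and E'_def = E'_def exp_inverse_def
  have pos: "E (x - l) + E (r - x) > 0" for x
    using assms by (auto simp: E_def add_pos_nonneg add_nonneg_pos)
  define B where "B = (\<lambda>x. E (x - l) * inverse (E (x - l) + E (r - x)))"
  define B' where "B' x = (E' (x - l) * E (r - x) + E (x - l) * E' (r - x)) / (E (x - l) + E (r -
      x))\<^sup>2" for x
  have "smooth B"
    unfolding B_def using pos
    by (intro smooth_mult smooth_inverse smooth_add smooth_comp[OF sE] smooth_intros) (metis
        less_irrefl)
  have "(B has_real_derivative B' x) (at x)" for x
    unfolding B_def B'_def using pos[of x]
    by (auto intro!: derivative_eq_intros DERIV_chain2[OF DE] simp: field_simps power2_eq_square)
  then have dB: "deriv B = B'"
    by (intro ext DERIV_imp_deriv)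
  show ?thesis
  proof (rule that[OF \<open>smooth B\<close>])
    show "B x = 0" if "x \<le> l" for x using that by (simp add: B_def E_def)
    show "B x = 1" if "r \<le> x" for x using that assms by (simp add: B_def E_def)
    show "deriv B x \<ge> 0" for x by (simp add: dB B'_def E_def E'_def)
    show "deriv B x > 0" if "l < x" "x < r" for x
      using that pos[of x] unfolding dB B'_def
      by (intro divide_pos_pos add_pos_pos mult_pos_pos) (auto simp: E_def E'_def)
  qed
qed

section \<open>Orders of contact with the identity\<close>

text \<open>Making the intermediate point a function of the two ends lets it be followed in
  limits.\<close>

lemma smooth_mvt_choice:
  assumes "smooth f"
  shows "\<exists>z. \<forall>x y. min x y \<le> z x y \<and> z x y \<le> max x y \<and> f y - f x = deriv f (z x y) * (y - x)"
proof -
  define P where "P x y z \<longleftrightarrow> min x y \<le> z \<and> z \<le> max x y \<and> f y - f x = deriv f z * (y - x)" for x y z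
  have "P x y (SOME z. P x y z)" for x y
    by (rule someI_ex, rule smooth_mvt[OF assms, of x y]) (auto simp: P_def)
  then show ?thesis
    unfolding P_def by (intro exI[of _ "\<lambda>x y. SOME z. P x y z"]) (simp add: P_def)
qed

lemma tendsto_between:
  fixes a b z :: "'a \<Rightarrow> real"
  assumes "(a \<longlongrightarrow> l) F" "(b \<longlongrightarrow> l) F" "\<And>x. min (a x) (b x) \<le> z x" "\<And>x. z x \<le> max (a x) (b x)"
  shows "(z \<longlongrightarrow> l) F"
  using tendsto_sandwich[OF _ _ tendsto_min[OF assms(1,2)], of z "\<lambda>x. max (a x) (b x)"]
    tendsto_max[OF assms(1,2)] assms(3,4) by simp

lemma diffeomorphism_filterlim_at_0:
  assumes "diffeomorphism g" "g 0 = 0"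
  shows "filterlim g (at 0) (at 0)"
proof -
  have "g x \<noteq> 0" if "x \<noteq> 0" for x
    using that assms diffeomorphism_bij[OF assms(1)] by (metis bij_pointE)
  moreover have "(g \<longlongrightarrow> 0) (at 0)"
    using smooth_isCont[OF diffeomorphism_smooth[OF assms(1)], of 0] assms(2) by (simp add:
        isCont_def)
  ultimately show ?thesis
    by (auto simp: filterlim_at eventually_at_filter)
qed

lemma smooth_quotient_tendsto:
  assumes "smooth g" "g 0 = 0"
  shows "((\<lambda>x. g x / x) \<longlongrightarrow> deriv g 0) (at 0)"
  using smooth_DERIV[OF assms(1), of 0] assms(2) by (simp add: has_field_derivative_iff)

text \<open>\<open>v (g x) / x ^ p\<close> is the product of \<open>v (g x) / g x ^ p\<close> and
  \<open>(g x / x) ^ p\<close>.\<close>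

lemma leading_term_comp:
  assumes v: "((\<lambda>x. v x / x ^ p) \<longlongrightarrow> a) (at 0)" and g: "filterlim g (at 0) (at 0)"
    and gx: "((\<lambda>x. g x / x) \<longlongrightarrow> m) (at 0)"
  shows "((\<lambda>x. v (g x) / x ^ p) \<longlongrightarrow> a * m ^ p) (at (0 :: real))"
proof -
  have "((\<lambda>x. v (g x) / g x ^ p * (g x / x) ^ p) \<longlongrightarrow> a * m ^ p) (at 0)"
    by (intro tendsto_intros filterlim_compose[OF v g] gx)
  moreover have "\<forall>\<^sub>F x in at 0. g x \<noteq> 0"
    using g by (auto simp: filterlim_at)
  then have "\<forall>\<^sub>F x in at 0. v (g x) / g x ^ p * (g x / x) ^ p = v (g x) / x ^ p"
    by eventually_elim (simp add: power_divide)
  ultimately show ?thesis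
    by (rule Lim_transform_eventually)
qed

text \<open>The relation says \<open>f h = h f^-1\<close> and \<open>f^-1 h = h f\<close>; passing
  \<open>f\<close> through both factors \<open>h\<close> inverts it twice.\<close>

lemma reversal_commutes:
  assumes f: "diffeomorphism f" and rev: "\<And>x. f (h (f x)) = h x"
  shows "f (h (h x)) = h (h (f x))"
proof -
  have "f (h (h x)) = h (finv f (h x))"
    using rev[of "finv f (h x)"] f by simp
  also have "finv f (h x) = h (f x)"
    using rev[of x] f by (metis diffeomorphism_inv_f)
  finally show ?thesis .
qed

text \<open>Conjugation by \<open>h\<close> exchanges \<open>f\<close> and its inverse, hence so
  does conjugation by the inverse of \<open>h\<close>.\<close>

lemma reversal_inv:
  assumes "diffeomorphism f" "diffeomorphism h" and rev: "\<And>x. f (h (f x)) = h x"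
  shows "f (finv h (f x)) = finv h x"
proof -
  have "h (f (finv h (f x))) = finv f (h (finv h (f x)))"
    using rev[of "finv h (f x)"] assms by (metis diffeomorphism_inv_f)
  then have "h (f (finv h (f x))) = x"
    using assms by simp
  then show ?thesis
    using assms by (metis diffeomorphism_inv_f)
qed

text \<open>If \<open>f - id\<close> has order \<open>p\<close> and \<open>h\<^sup>2 - id\<close> has order \<open>r\<close>, comparing leading coefficients in
  \<open>f h f = h\<close> forces \<open>h'(0) = -1\<close> and \<open>p\<close> even, in \<open>h\<^sup>2 h = h h\<^sup>2\<close> it forces \<open>r\<close> odd, and in
  \<open>f h\<^sup>2 = h\<^sup>2 f\<close> it forces \<open>p = r\<close>.\<close>

lemma not_both_nonflat:
  assumes f: "diffeomorphism f" "strict_mono f" "f 0 = 0"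
    and h: "diffeomorphism h" "strict_antimono_on UNIV h" "h 0 = 0"
    and rev: "\<And>x. f (h (f x)) = h x"
    and nf: "\<not> flat (\<lambda>x. f x - x)" and nk: "\<not> flat (\<lambda>x. h (h x) - x)"
  shows False
proof -
  define v where "v = (\<lambda>x. f x - x)"
  define u where "u = (\<lambda>x. h (h x) - x)"
  define l where "l = deriv h 0"
  define m where "m = deriv f 0"
  have l: "l < 0" and m: "m > 0"
    using diffeomorphism_deriv_neg[OF h(1,2)] diffeomorphism_deriv_pos[OF f(1,2)] by (auto simp:
        l_def m_def)
  note sf = diffeomorphism_smooth[OF f(1)] and sh = diffeomorphism_smooth[OF h(1)]
  have sv: "smooth v" and su: "smooth u"
    unfolding v_def u_def by (intro smooth_diff sf smooth_comp[OF sh sh] smooth_ident)+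
  obtain p a where p: "p > 0" "a \<noteq> 0" and va: "((\<lambda>x. v x / x ^ p) \<longlongrightarrow> a) (at 0)"
    and va': "((\<lambda>x. deriv v x / x ^ (p - 1)) \<longlongrightarrow> of_nat p * a) (at 0)"
    by (rule nonflat_leading_term[OF sv]) (use nf f(3) in \<open>auto simp: v_def\<close>)
  obtain r b where r: "r > 0" "b \<noteq> 0" and ub: "((\<lambda>x. u x / x ^ r) \<longlongrightarrow> b) (at 0)"
    and ub': "((\<lambda>x. deriv u x / x ^ (r - 1)) \<longlongrightarrow> of_nat r * b) (at 0)"
    by (rule nonflat_leading_term[OF su]) (use nk h(3) in \<open>auto simp: u_def\<close>)
  obtain zh where zh: "\<And>x y. min x y \<le> zh x y" "\<And>x y. zh x y \<le> max x y"
    "\<And>x y. h y - h x = deriv h (zh x y) * (y - x)"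
    using smooth_mvt_choice[OF sh] by auto
  have h0: "filterlim h (at 0) (at 0)" and f0: "filterlim f (at 0) (at 0)"
    using diffeomorphism_filterlim_at_0 f h by auto
  have hl: "((\<lambda>x. h x / x) \<longlongrightarrow> l) (at 0)" and fm: "((\<lambda>x. f x / x) \<longlongrightarrow> m) (at 0)"
    unfolding l_def m_def using smooth_quotient_tendsto sf sh f(3) h(3) by auto
  have id0: "((\<lambda>x. x) \<longlongrightarrow> 0) (at (0::real))" by (rule tendsto_ident_at)
  have f_lim: "(f \<longlongrightarrow> 0) (at 0)" and h_lim: "(h \<longlongrightarrow> 0) (at 0)"
    using f0 h0 by (auto simp: filterlim_at)
  have hh0: "filterlim (\<lambda>x. h (h x)) (at 0) (at 0)" and hf0: "filterlim (\<lambda>x. h (f x)) (at 0) (at 0)"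
    by (rule filterlim_compose[OF h0 h0], rule filterlim_compose[OF h0 f0])
  then have hh_lim: "((\<lambda>x. h (h x)) \<longlongrightarrow> 0) (at 0)"
    by (auto simp: filterlim_at)
  have hf_quot: "((\<lambda>x. h (f x) / x) \<longlongrightarrow> l * m) (at 0)"
    using leading_term_comp[of h 1 l f m] hl f0 fm by simp
  have hh_quot: "((\<lambda>x. h (h x) / x) \<longlongrightarrow> l * l) (at 0)"
    using leading_term_comp[of h 1 l h l] hl h0 by simp
  have dh: "((\<lambda>x. deriv h (zh (A x) (B x))) \<longlongrightarrow> l) (at 0)"
    if "(A \<longlongrightarrow> 0) (at 0)" "(B \<longlongrightarrow> 0) (at 0)" for A B
    unfolding l_def
    by (rule isCont_tendsto_compose[OF smooth_isCont[OF smooth_deriv[OF sh]] tendsto_between[OF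
        that]])
      (rule zh)+

  \<comment> \<open>\<open>f h f = h\<close> turns \<open>v (h (f x))\<close> into
    \<open>h x - h (f x)\<close>; comparing coefficients of \<open>x ^ p\<close> gives
    \<open>a (l m)^p = - l a\<close>.\<close>
  have "v (h (f x)) / x ^ p = - deriv h (zh x (f x)) * (v x / x ^ p)" for x
    using rev[of x] zh(3)[where x = x and y = "f x"] by (simp add: v_def algebra_simps)
  moreover have "((\<lambda>x. v (h (f x)) / x ^ p) \<longlongrightarrow> a * (l * m) ^ p) (at 0)"
    by (rule leading_term_comp[OF va hf0 hf_quot])
  moreover have "((\<lambda>x. - deriv h (zh x (f x)) * (v x / x ^ p)) \<longlongrightarrow> - l * a) (at 0)"
    by (intro tendsto_intros va dh id0 f_lim)
  ultimately have "a * (l * m) ^ p = - l * a"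
    using LIM_unique by simp
  then have "a * (l * m) ^ p = a * - l"
    by simp
  then have lm: "(l * m) ^ p = - l"
    using p(2) mult_left_cancel by blast
  \<comment> \<open>For \<open>p = 1\<close> the left side of \<open>lm\<close> would be negative
    and the right side positive.\<close>
  have p1: "p > 1"
  proof (rule ccontr)
    assume "\<not> p > 1"
    then have "p = 1" using p by simp
    with lm l mult_neg_pos[OF l m] show False by simp
  qed
  \<comment> \<open>As \<open>p > 1\<close>, the quotient \<open>f x / x\<close> tends to
    \<open>1\<close>.\<close>
  have "((\<lambda>x. v x / x ^ p * x ^ (p - 1)) \<longlongrightarrow> a * 0 ^ (p - 1)) (at 0)"
    by (intro tendsto_intros va)
  moreover have "v x / x ^ p * x ^ (p - 1) = f x / x - 1" if "x \<noteq> 0" for x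
  proof -
    have "x ^ p = x * x ^ (p - 1)"
      using p by (simp add: power_eq_if)
    then show ?thesis
      using that by (simp add: v_def) (simp add: diff_divide_distrib)
  qed
  then have "\<forall>\<^sub>F x in at 0. v x / x ^ p * x ^ (p - 1) = f x / x - 1"
    by (simp add: eventually_at_filter)
  ultimately have "((\<lambda>x. f x / x - 1) \<longlongrightarrow> 0) (at 0)"
    using p1 by (auto simp: power_0_left intro: Lim_transform_eventually)
  moreover have "((\<lambda>x. f x / x - 1) \<longlongrightarrow> m - 1) (at 0)"
    by (intro tendsto_intros fm)
  ultimately have m1: "m = 1"
    using LIM_unique by force
  have "\<bar>l\<bar> * \<bar>l\<bar> ^ (p - 1) = \<bar>l\<bar> ^ p"
    using p by (simp add: power_eq_if)
  also have "\<dots> = \<bar>l\<bar> * 1"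
    using lm m1 by (simp flip: power_abs)
  finally have "\<bar>l\<bar> * \<bar>l\<bar> ^ (p - 1) = \<bar>l\<bar> * 1" .
  then have "\<bar>l\<bar> ^ (p - 1) = 1"
    using l by simp
  then have l1: "l = - 1"
    using p1 l power_eq_imp_eq_base[of "\<bar>l\<bar>" "p - 1" 1] by auto
  with lm m1 have "even p"
    by (cases "even p") auto

  \<comment> \<open>\<open>u (h x)\<close> is the increment of \<open>h\<close> from
    \<open>x\<close> to \<open>h (h x)\<close>, which leads to the coefficient relation
    \<open>b l^r = l b\<close>.\<close>
  have "u (h x) = deriv h (zh x (h (h x))) * u x" for x
    using zh(3)[where x = x and y = "h (h x)"] by (simp add: u_def)
  then have "(\<lambda>x. u (h x) / x ^ r) = (\<lambda>x. deriv h (zh x (h (h x))) * (u x / x ^ r))"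
    by (simp add: fun_eq_iff)
  moreover have "((\<lambda>x. deriv h (zh x (h (h x))) * (u x / x ^ r)) \<longlongrightarrow> l * b) (at 0)"
    by (intro tendsto_intros ub dh id0 hh_lim)
  ultimately have "((\<lambda>x. u (h x) / x ^ r) \<longlongrightarrow> l * b) (at 0)"
    by simp
  then have "b * l ^ r = l * b"
    by (rule LIM_unique[OF leading_term_comp[OF ub h0 hl]])
  then have "odd r"
    using r l1 by (cases "even r") auto

  \<comment> \<open>If \<open>z x\<close> lies between \<open>x\<close> and \<open>g x\<close> and
    \<open>g x / x\<close> tends to \<open>1\<close>, then so does \<open>z x / x\<close>; hence a
    leading term of \<open>deriv w\<close> survives evaluation at \<open>z x\<close>.\<close>
  have deriv_quot: "((\<lambda>x. deriv w (z x) / x ^ q) \<longlongrightarrow> c) (at 0)"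
    if w: "((\<lambda>x. deriv w x / x ^ q) \<longlongrightarrow> c) (at 0)"
      and z: "\<And>x. min x (g x) \<le> z x" "\<And>x. z x \<le> max x (g x)"
      and g: "diffeomorphism g" "strict_mono g" "g 0 = 0" "((\<lambda>x. g x / x) \<longlongrightarrow> 1) (at 0)"
    for w z q c g
  proof -
    have "z x \<noteq> 0" if "x \<noteq> 0" for x
      using z[of x] that g(3) strict_mono_less[OF g(2), of x 0] strict_mono_less[OF g(2), of 0 x]
          by linarith
    moreover have "(z \<longlongrightarrow> 0) (at 0)"
      using tendsto_between[OF id0 _ z] diffeomorphism_filterlim_at_0[OF g(1,3)] by (auto simp:
          filterlim_at)
    ultimately have z0: "filterlim z (at 0) (at 0)"
      by (auto simp: filterlim_at eventually_at_filter)
    have A: "((\<lambda>x. \<bar>g x / x - 1\<bar>) \<longlongrightarrow> 0) (at 0)"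
      using tendsto_rabs[OF tendsto_diff[OF g(4) tendsto_const[of 1]]] by simp
    have "norm (z x / x - 1) \<le> \<bar>g x / x - 1\<bar>" if "x \<noteq> 0" for x
    proof -
      have "\<bar>z x - x\<bar> / \<bar>x\<bar> \<le> \<bar>g x - x\<bar> / \<bar>x\<bar>"
        using z[of x] by (intro divide_right_mono) auto
      then show ?thesis
        using that by (simp add: diff_divide_distrib flip: abs_divide)
    qed
    then have "\<forall>\<^sub>F x in at 0. norm (z x / x - 1) \<le> \<bar>g x / x - 1\<bar>"
      by (simp add: eventually_at_filter)
    then have "((\<lambda>x. z x / x - 1) \<longlongrightarrow> 0) (at 0)"
      by (rule Lim_null_comparison[OF _ A])
    then have "((\<lambda>x. z x / x - 1 + 1) \<longlongrightarrow> 0 + 1) (at 0)"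
      by (intro tendsto_add tendsto_const)
    then show ?thesis
      using leading_term_comp[OF w z0, of 1] by simp
  qed
  obtain zv where zv: "\<And>x y. min x y \<le> zv x y" "\<And>x y. zv x y \<le> max x y"
    "\<And>x y. v y - v x = deriv v (zv x y) * (y - x)"
    using smooth_mvt_choice[OF sv] by auto
  obtain zu where zu: "\<And>x y. min x y \<le> zu x y" "\<And>x y. zu x y \<le> max x y"
    "\<And>x y. u y - u x = deriv u (zu x y) * (y - x)"
    using smooth_mvt_choice[OF su] by auto
  have hh: "diffeomorphism (\<lambda>x. h (h x))" "strict_mono (\<lambda>x. h (h x))"
    using h diffeomorphism_comp' by (auto simp: strict_mono_def monotone_def)
  \<comment> \<open>\<open>f h^2 = h^2 f\<close> says that the increment of \<open>v\<close> from
    \<open>x\<close> to \<open>h (h x)\<close> equals that of \<open>u\<close> from \<open>x\<close>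
    to \<open>f x\<close>.\<close>
  have "deriv v (zv x (h (h x))) * u x = deriv u (zu x (f x)) * v x" for x
  proof -
    have "v (h (h x)) - v x = deriv v (zv x (h (h x))) * (h (h x) - x)"
      "u (f x) - u x = deriv u (zu x (f x)) * (f x - x)"
      by (rule zv(3), rule zu(3))
    then show ?thesis
      using reversal_commutes[of f h x, OF f(1) rev] by (simp add: u_def v_def)
  qed
  \<comment> \<open>Both exponents equal \<open>p + r - 1\<close>; each is split to match its own
    pair of factors.\<close>
  then have "deriv v (zv x (h (h x))) * u x / x ^ (p - 1 + r) = deriv u (zu x (f x)) * v x / x ^
      (r - 1 + p)" for x
    using p r by (simp add: add.commute[of r p])
  then have eq: "(\<lambda>x. (deriv v (zv x (h (h x))) / x ^ (p - 1)) * (u x / x ^ r))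
      = (\<lambda>x. (deriv u (zu x (f x)) / x ^ (r - 1)) * (v x / x ^ p))"
    by (simp add: power_add)
  have "((\<lambda>x. (deriv v (zv x (h (h x))) / x ^ (p - 1)) * (u x / x ^ r)) \<longlongrightarrow> of_nat p * a * b) (at 0)"
    using hh_quot l1 h(3) by (intro tendsto_mult ub deriv_quot[OF va' zv(1,2) hh]) auto
  moreover have "((\<lambda>x. (deriv u (zu x (f x)) / x ^ (r - 1)) * (v x / x ^ p)) \<longlongrightarrow> of_nat r * b * a)
      (at 0)"
    using fm m1 f(3) by (intro tendsto_mult va deriv_quot[OF ub' zu(1,2) f(1,2)]) auto
  ultimately have "of_nat p * a * b = of_nat r * b * a"
    unfolding eq by (rule LIM_unique)
  then have "p = r"
    using p r by simp
  with \<open>even p\<close> \<open>odd r\<close> show False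
    by simp
qed

text \<open>\<open>h x - finv h x\<close> is the increment of \<open>finv h\<close> from
  \<open>x\<close> to \<open>h (h x)\<close>, hence near \<open>0\<close> a bounded multiple of a
  flat function. This is what makes gluing \<open>h\<close> to its inverse smooth.\<close>

lemma flat_diff_inv:
  assumes h: "diffeomorphism h" "h 0 = 0" and fl: "flat (\<lambda>x. h (h x) - x)"
  shows "flat (\<lambda>x. h x - finv h x)"
proof (rule flatI)
  note sh = diffeomorphism_smooth[OF h(1)]
  note si = diffeomorphism_smooth[OF diffeomorphism_inv[OF h(1)]]
  show "smooth (\<lambda>x. h x - finv h x)"
    by (intro smooth_diff sh si)
  fix p
  obtain z where z: "\<And>x y. min x y \<le> z x y" "\<And>x y. z x y \<le> max x y"
    "\<And>x y. finv h y - finv h x = deriv (finv h) (z x y) * (y - x)"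
    using smooth_mvt_choice[OF si] by auto
  have "((\<lambda>x. h (h x)) \<longlongrightarrow> 0) (at 0)"
    using smooth_isCont[OF smooth_comp[OF sh sh], of 0] h(2) by (simp add: isCont_def)
  then have "((\<lambda>x. deriv (finv h) (z x (h (h x)))) \<longlongrightarrow> deriv (finv h) 0) (at 0)"
    using isCont_tendsto_compose[OF smooth_isCont[OF smooth_deriv[OF si]]
        tendsto_between[OF tendsto_ident_at _ z(1,2)]] by blast
  moreover have "((\<lambda>x. (h (h x) - x) / x ^ p) \<longlongrightarrow> 0) (at 0)"
    by (intro flat_tendsto fl smooth_diff smooth_comp[OF sh sh] smooth_ident)
  ultimately have "((\<lambda>x. deriv (finv h) (z x (h (h x))) * ((h (h x) - x) / x ^ p)) \<longlongrightarrow> deriv (finv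
      h) 0 * 0) (at 0)"
    by (rule tendsto_mult)
  moreover have "deriv (finv h) (z x (h (h x))) * ((h (h x) - x) / x ^ p) = (h x - finv h x) / x ^
      p" for x
    using z(3)[where x = x and y = "h (h x)"] h(1) by simp
  ultimately show "((\<lambda>x. (h x - finv h x) / x ^ p) \<longlongrightarrow> 0) (at 0)"
    by (simp only: mult_zero_right)
qed

section \<open>Reversing involutions\<close>

text \<open>Strong reversibility without group inverses: \<open>f t f = t\<close> replaces
  \<open>t f t^-1 = f^-1\<close>, and a smooth involution is automatically a diffeomorphism.\<close>

definition involution_reverses :: "(real \<Rightarrow> real) \<Rightarrow> bool" where
  "involution_reverses f \<longleftrightarrow> (\<exists>t. smooth t \<and> (\<forall>x. t (t x) = x) \<and> (\<forall>x. f (t (f x)) = t x))"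

section \<open>Diffeomorphisms without fixed points\<close>

lemma funpow_eventually_ge:
  fixes f :: "real \<Rightarrow> real"
  assumes "continuous_on UNIV f" "\<And>x. x < f x"
  shows "\<exists>N. \<forall>n\<ge>N. M \<le> (f ^^ n) x"
proof -
  have inc: "incseq (\<lambda>n. (f ^^ n) x)"
    using assms(2) by (intro incseq_SucI) (simp add: less_imp_le)
  \<comment> \<open>A bounded increasing orbit would converge to a fixed point.\<close>
  have "\<exists>N. M \<le> (f ^^ N) x"
  proof (rule ccontr)
    assume "\<not> ?thesis"
    then have "\<forall>n. (f ^^ n) x \<le> M"
      by (metis linear)
    then obtain L where L: "(\<lambda>n. (f ^^ n) x) \<longlonglongrightarrow> L"
      using incseq_convergent[OF inc] by blast
    have "(\<lambda>n. f ((f ^^ n) x)) \<longlonglongrightarrow> f L"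
      using L assms(1) isCont_tendsto_compose[of L f] by (simp add: continuous_on_eq_continuous_at)
    moreover have "(\<lambda>n. f ((f ^^ n) x)) \<longlonglongrightarrow> L"
      using LIMSEQ_Suc[OF L] by simp
    ultimately have "f L = L"
      by (rule LIMSEQ_unique)
    then show False
      using assms(2)[of L] by simp
  qed
  then show ?thesis
    using incseqD[OF inc] order.trans by blast
qed

lemma funpow_eventually_le:
  fixes f :: "real \<Rightarrow> real"
  assumes "continuous_on UNIV f" "\<And>x. f x < x"
  shows "\<exists>N. \<forall>n\<ge>N. (f ^^ n) x \<le> M"
proof -
  define g where "g x = - f (- x)" for x
  have "continuous_on UNIV g"
    unfolding g_def using assms(1)
    by (intro continuous_intros continuous_on_compose2[OF assms(1)]) auto
  moreover have "x < g x" for x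
    using assms(2)[of "- x"] by (simp add: g_def)
  moreover have "(g ^^ n) (- x) = - (f ^^ n) x" for n
    by (induction n) (auto simp: g_def)
  ultimately show ?thesis
    using funpow_eventually_ge[of g "- M" "- x"] by simp
qed

text \<open>With \<open>B\<close> a smooth step, \<open>B (f\<^sup>-\<^sup>n\<^sup>-\<^sup>1 x) - (1 - B (f\<^sup>n x))\<close> vanishes for large \<open>n\<close>, and the
  sum over \<open>n\<close> telescopes to a smooth conjugacy of \<open>f\<close> with a unit translation.\<close>

lemma conjugate_to_translation:
  assumes f: "diffeomorphism f" "strict_mono f" and up: "\<And>x. x < f x"
  obtains \<phi> where "diffeomorphism \<phi>" "\<And>x. \<phi> (f x) = \<phi> x + 1"
proof -
  define g where "g = finv f"
  have g: "diffeomorphism g" "strict_mono g"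
    using f diffeomorphism_inv strict_mono_inv_diffeomorphism by (auto simp: g_def)
  have fg [simp]: "f (g x) = x" "g (f x) = x" for x
    using f by (auto simp: g_def)
  have down: "g x < x" for x
    using up[of "g x"] by simp
  have sf: "smooth (f ^^ n)" and sg: "smooth (g ^^ n)" for n
    using f g diffeomorphism_smooth diffeomorphism_funpow by blast+
  have df: "deriv (f ^^ n) x > 0" and dg: "deriv (g ^^ n) x > 0" for n x
    using f g diffeomorphism_deriv_pos diffeomorphism_funpow strict_mono_funpow by blast+
  note mono_f = strict_mono_less_eq[OF strict_mono_funpow[OF f(2)]]
  note mono_g = strict_mono_less_eq[OF strict_mono_funpow[OF g(2)]]
  note cont_f = smooth_continuous_on[OF diffeomorphism_smooth[OF f(1)]]
  note cont_g = smooth_continuous_on[OF diffeomorphism_smooth[OF g(1)]]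
  \<comment> \<open>The interval on which \<open>B\<close> has positive derivative contains
    \<open>[0, f 0]\<close>, a fundamental domain of \<open>f\<close>.\<close>
  define l r :: real where "l = - 1" and "r = f 0 + 1"
  have "l < r"
    using up[of 0] by (simp add: l_def r_def)
  then obtain B where B: "smooth B" "\<And>x. x \<le> l \<Longrightarrow> B x = 0" "\<And>x. r \<le> x \<Longrightarrow> B x = 1"
    "\<And>x. deriv B x \<ge> 0" "\<And>x. l < x \<Longrightarrow> x < r \<Longrightarrow> deriv B x > 0"
    using smooth_step by blast
  define \<beta> where "\<beta> n x = B ((g ^^ Suc n) x) - (1 - B ((f ^^ n) x))" for n x
  define \<beta>' where "\<beta>' n x = deriv B ((g ^^ Suc n) x) * deriv (g ^^ Suc n) x
      + deriv B ((f ^^ n) x) * deriv (f ^^ n) x" for n x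
  define \<phi> where "\<phi> x = (\<Sum>n. \<beta> n x)" for x
  have s\<beta>: "smooth (\<beta> n)" for n
    unfolding \<beta>_def by (intro smooth_diff smooth_const smooth_comp[OF B(1) sf] smooth_comp[OF B(1)
        sg])
  have D\<beta>: "(\<beta> n has_real_derivative \<beta>' n x) (at x)" for n x
  proof -
    have "(\<beta> n has_real_derivative deriv B ((g ^^ Suc n) x) * deriv (g ^^ Suc n) x
        - (0 - deriv B ((f ^^ n) x) * deriv (f ^^ n) x)) (at x)"
      unfolding \<beta>_def
      by (intro DERIV_diff DERIV_const DERIV_chain2[OF smooth_DERIV[OF B(1)]] smooth_DERIV sf sg)
    then show ?thesis by (simp add: \<beta>'_def)
  qed
  have \<beta>'_nonneg: "\<beta>' n x \<ge> 0" for n x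
    unfolding \<beta>'_def by (intro add_nonneg_nonneg mult_nonneg_nonneg B(4) less_imp_le[OF df]
        less_imp_le[OF dg])
  \<comment> \<open>Every orbit meets \<open>[0, f 0]\<close>: take the first forward iterate that
    is at least \<open>0\<close>, or for \<open>x > f 0\<close> the first backward iterate that is
    at most \<open>f 0\<close>.\<close>
  have \<beta>'_pos: "\<exists>n. \<beta>' n x > 0" for x
  proof (cases "x \<le> f 0")
    case True
    obtain n where n: "0 \<le> (f ^^ n) x" "\<And>m. m < n \<Longrightarrow> (f ^^ m) x < 0"
      using funpow_eventually_ge[OF cont_f up, of 0 x] exists_least_iff[of "\<lambda>n. 0 \<le> (f ^^ n) x"]
      by (metis not_less order.refl)
    have "(f ^^ n) x \<le> f 0"
    proof (cases n)
      case (Suc m)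
      then show ?thesis
        using n(2)[of m] strict_mono_less[OF f(2), of "(f ^^ m) x" 0] by simp
    qed (use True in simp)
    then have "deriv B ((f ^^ n) x) > 0"
      using n(1) by (intro B(5)) (auto simp: l_def r_def)
    then have "\<beta>' n x > 0"
      unfolding \<beta>'_def by (intro add_nonneg_pos mult_nonneg_nonneg mult_pos_pos B(4) df
          less_imp_le[OF dg])
    then show ?thesis ..
  next
    case False
    obtain n where n: "(g ^^ n) x \<le> f 0" "\<And>m. m < n \<Longrightarrow> f 0 < (g ^^ m) x"
      using funpow_eventually_le[OF cont_g down, of x "f 0"] exists_least_iff[of "\<lambda>n. (g ^^ n) x \<le>
          f 0"]
      by (metis not_less order.refl)
    \<comment> \<open>As \<open>x > f 0\<close>, at least one backward step is needed, which fits
      the index shift in \<open>\<beta>\<close>.\<close>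
    then obtain m where m: "n = Suc m"
      using False by (cases n) auto
    have "0 < (g ^^ n) x"
      using n(2)[of m] strict_mono_less[OF g(2), of "f 0" "(g ^^ m) x"] m by simp
    then have "deriv B ((g ^^ Suc m) x) > 0"
      using n(1) m by (intro B(5)) (auto simp: l_def r_def)
    then have "\<beta>' m x > 0"
      unfolding \<beta>'_def by (intro add_pos_nonneg mult_nonneg_nonneg mult_pos_pos B(4) dg
          less_imp_le[OF df])
    then show ?thesis ..
  qed
  \<comment> \<open>By monotonicity of the iterates, the bounds at \<open>x - 1\<close> and
    \<open>x + 1\<close> serve the whole neighbourhood, so the series is locally a finite
    sum.\<close>
  have loc: "\<exists>N. \<forall>n\<ge>N. \<forall>y. \<bar>y - x\<bar> < 1 \<longrightarrow> B ((f ^^ n) y) = 1 \<and> B ((g ^^ n) y) = 0" for x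
  proof -
    obtain N1 where N1: "\<And>n. n \<ge> N1 \<Longrightarrow> r \<le> (f ^^ n) (x - 1)"
      using funpow_eventually_ge[OF cont_f up] by blast
    obtain N2 where N2: "\<And>n. n \<ge> N2 \<Longrightarrow> (g ^^ n) (x + 1) \<le> l"
      using funpow_eventually_le[OF cont_g down] by blast
    have "B ((f ^^ n) y) = 1 \<and> B ((g ^^ n) y) = 0" if "n \<ge> max N1 N2" "\<bar>y - x\<bar> < 1" for n y
    proof -
      have "(f ^^ n) (x - 1) \<le> (f ^^ n) y" "(g ^^ n) y \<le> (g ^^ n) (x + 1)"
        unfolding mono_f mono_g using that by auto
      then show ?thesis
        using N1[of n] N2[of n] that by (intro conjI B(2,3)) auto
    qed
    then show ?thesis by blast
  qed
  have sum: "\<phi> y = (\<Sum>n<N. \<beta> n y)" if "\<And>n. n \<ge> N \<Longrightarrow> B ((f ^^ n) y) = 1 \<and> B ((g ^^ n) y) = 0" for N y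
    unfolding \<phi>_def
  proof (rule suminf_finite)
    fix n assume "n \<notin> {..<N}"
    then have "N \<le> n" "N \<le> Suc n" by auto
    then show "\<beta> n y = 0"
      using that[of n] that[of "Suc n"] unfolding \<beta>_def by simp
  qed simp
  \<comment> \<open>Every large \<open>M\<close> is allowed, so that a positive term of the
    derivative can be included.\<close>
  have ev: "\<exists>N. \<forall>M\<ge>N. \<forall>\<^sub>F y in nhds x. \<phi> y = (\<Sum>n<M. \<beta> n y)" for x
  proof -
    obtain N where N: "\<And>n y. n \<ge> N \<Longrightarrow> \<bar>y - x\<bar> < 1 \<Longrightarrow> B ((f ^^ n) y) = 1 \<and> B ((g ^^ n) y) = 0"
      using loc by metis
    have "\<forall>\<^sub>F y in nhds x. \<phi> y = (\<Sum>n<M. \<beta> n y)" if "M \<ge> N" for M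
      unfolding eventually_nhds_metric
      by (rule exI[of _ 1]) (use N that sum in \<open>auto simp: dist_real_def\<close>)
    then show ?thesis by blast
  qed
  have s\<phi>: "smooth \<phi>"
  proof (rule smooth_local)
    fix x
    obtain N where "\<forall>\<^sub>F y in nhds x. \<phi> y = (\<Sum>n<N. \<beta> n y)"
      using ev by blast
    moreover have "smooth (\<lambda>y. \<Sum>n<N. \<beta> n y)"
      by (intro smooth_sum s\<beta>)
    ultimately show "\<exists>g. smooth g \<and> (\<forall>\<^sub>F y in nhds x. \<phi> y = g y)"
      by blast
  qed
  have d\<phi>: "deriv \<phi> x > 0" for x
  proof -
    obtain N where N: "\<And>M. M \<ge> N \<Longrightarrow> \<forall>\<^sub>F y in nhds x. \<phi> y = (\<Sum>n<M. \<beta> n y)"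
      using ev by blast
    obtain n where n: "\<beta>' n x > 0"
      using \<beta>'_pos by blast
    define M where "M = max N (Suc n)"
    have "((\<lambda>y. \<Sum>n<M. \<beta> n y) has_real_derivative (\<Sum>n<M. \<beta>' n x)) (at x)"
      by (intro DERIV_sum D\<beta>)
    then have "deriv \<phi> x = (\<Sum>n<M. \<beta>' n x)"
      using DERIV_imp_deriv deriv_cong_ev[OF N[of M] refl] by (simp add: M_def)
    also have "\<dots> > 0"
      using n \<beta>'_nonneg by (intro sum_pos2[of _ n]) (auto simp: M_def)
    finally show ?thesis .
  qed
  have conj: "\<phi> (f x) = \<phi> x + 1" for x
  proof -
    have loc': "\<exists>N. \<forall>n\<ge>N. B ((f ^^ n) y) = 1 \<and> B ((g ^^ n) y) = 0" for y
    proof -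
      obtain N where "\<forall>n\<ge>N. \<forall>z. \<bar>z - y\<bar> < 1 \<longrightarrow> B ((f ^^ n) z) = 1 \<and> B ((g ^^ n) z) = 0"
        using loc by blast
      moreover have "\<bar>y - y\<bar> < 1" by simp
      ultimately show ?thesis by blast
    qed
    obtain N1 where N1: "\<And>n. n \<ge> N1 \<Longrightarrow> B ((f ^^ n) x) = 1 \<and> B ((g ^^ n) x) = 0"
      using loc' by blast
    obtain N2 where N2: "\<And>n. n \<ge> N2 \<Longrightarrow> B ((f ^^ n) (f x)) = 1 \<and> B ((g ^^ n) (f x)) = 0"
      using loc' by blast
    define N where "N = max N1 N2"
    have e: "(g ^^ Suc n) (f x) = (g ^^ n) x" "(f ^^ n) (f x) = (f ^^ Suc n) x" for n
      by (simp_all add: funpow_Suc_right del: funpow.simps)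
    have "\<phi> (f x) - \<phi> x = (\<Sum>n<N. \<beta> n (f x)) - (\<Sum>n<N. \<beta> n x)"
      using N1 N2 by (subst (1 2) sum[of N]) (auto simp: N_def)
    \<comment> \<open>Replacing \<open>x\<close> by \<open>f x\<close> lowers the backward index and
      raises the forward index by one, so both differences telescope.\<close>
    also have "\<dots> = (\<Sum>n<N. (B ((g ^^ n) x) - B ((g ^^ Suc n) x)) + (B ((f ^^ Suc n) x) - B ((f ^^
        n) x)))"
      unfolding sum_subtractf[symmetric] \<beta>_def e by (intro sum.cong) auto
    also have "\<dots> = (B ((g ^^ 0) x) - B ((g ^^ N) x)) + (B ((f ^^ N) x) - B ((f ^^ 0) x))"
      unfolding sum.distrib sum_lessThan_telescope[of "\<lambda>n. B ((f ^^ n) x)"]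
        sum_lessThan_telescope'[of "\<lambda>n. B ((g ^^ n) x)"] ..
    also have "\<dots> = 1"
      using N1[of N] by (simp add: N_def)
    finally show ?thesis by simp
  qed
  have "surj \<phi>"
  proof -
    have c: "continuous_on S \<phi>" for S
      by (rule smooth_continuous_on[OF s\<phi>])
    \<comment> \<open>Along the orbit of \<open>0\<close> the values are unbounded in both
      directions.\<close>
    have "\<phi> ((f ^^ n) 0) = \<phi> 0 + of_nat n" for n
      by (induction n) (auto simp: conj)
    moreover have "\<phi> ((g ^^ n) 0) = \<phi> 0 - of_nat n" for n
    proof (induction n)
      case (Suc n)
      then show ?case using conj[of "g ((g ^^ n) 0)"] by simp
    qed simp
    moreover have "(g ^^ n) 0 \<le> (f ^^ n) 0" for n
    proof (induction n)
      case (Suc n)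
      then show ?case using up[of "(f ^^ n) 0"] down[of "(g ^^ n) 0"] by simp
    qed simp
    ultimately have "\<exists>x. \<phi> x = y" if "\<bar>y - \<phi> 0\<bar> \<le> of_nat n" for y n
      using IVT'[of \<phi> "(g ^^ n) 0" y "(f ^^ n) 0", OF _ _ _ c] that by (auto simp: abs_le_iff)
    then show ?thesis
      using real_arch_simple unfolding surj_def by metis
  qed
  then have "diffeomorphism \<phi>"
    by (intro diffeomorphismI s\<phi> d\<phi>)
  then show ?thesis
    using that conj by blast
qed

text \<open>A translation is reversed by \<open>x -> - x\<close>, and the conjugacy transports this
  to \<open>t\<close>. A map without fixed points lies on one side of the identity; if below, its
  inverse lies above and has the same reversing involutions.\<close>

lemma involution_reverses_if_no_fixed_points:
  assumes f: "diffeomorphism f" "strict_mono f" and nofix: "\<And>x. f x \<noteq> x"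
  shows "involution_reverses f"
proof -
  have up: "involution_reverses k" if k: "diffeomorphism k" "strict_mono k" "\<And>x. x < k x" for k
  proof -
    obtain \<phi> where \<phi>: "diffeomorphism \<phi>" "\<And>x. \<phi> (k x) = \<phi> x + 1"
      using conjugate_to_translation[OF k] by blast
    define t where "t x = finv \<phi> (- \<phi> x)" for x
    have \<phi>t: "\<phi> (t x) = - \<phi> x" for x
      using \<phi>(1) by (simp add: t_def)
    have "t (t x) = x" for x
      using \<phi>(1) by (simp add: t_def)
    moreover have "k (t (k x)) = t x" for x
    proof -
      have "\<phi> (k (t (k x))) = \<phi> (t x)"
        by (simp add: \<phi> \<phi>t)
      then show ?thesis
        using \<phi>(1) by (metis diffeomorphism_inv_f)
    qed
    moreover have "smooth t"
      unfolding t_def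
      by (rule smooth_comp[OF diffeomorphism_smooth[OF diffeomorphism_inv[OF \<phi>(1)]]
            smooth_minus[OF diffeomorphism_smooth[OF \<phi>(1)]]])
    ultimately show ?thesis
      by (auto simp: involution_reverses_def)
  qed
  show ?thesis
  proof (cases "\<forall>x. x < f x")
    case True
    then show ?thesis using up f by blast
  next
    case False
    then obtain x0 where x0: "f x0 < x0"
      using nofix by (metis linorder_neqE_linordered_idom)
    have down: "f x < x" for x
    proof (rule ccontr)
      assume "\<not> f x < x"
      moreover have c: "continuous_on UNIV (\<lambda>x. f x - x)"
        by (intro continuous_intros smooth_continuous_on diffeomorphism_smooth f)
      ultimately have "\<exists>z. f z - z = 0"
      proof (cases "x \<le> x0")
        case True
        then show ?thesis
          by (rule IVT_sign_change[OF c]) (use x0 \<open>\<not> f x < x\<close> in auto)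
      next
        case False
        then have "x0 \<le> x" by simp
        then show ?thesis
          by (rule IVT_sign_change[OF c]) (use x0 \<open>\<not> f x < x\<close> in auto)
      qed
      then show False using nofix by auto
    qed
    have "x < finv f x" for x
      using down[of "finv f x"] f(1) by simp
    then have "involution_reverses (finv f)"
      using up[OF diffeomorphism_inv strict_mono_inv_diffeomorphism] f by blast
    then obtain t where t: "smooth t" "\<And>x. t (t x) = x" "\<And>x. finv f (t (finv f x)) = t x"
      by (auto simp: involution_reverses_def)
    have "f (t (f x)) = t x" for x
      using t(3)[of "f x"] f(1) by (metis diffeomorphism_f_inv diffeomorphism_inv_f)
    then show ?thesis
      using t by (auto simp: involution_reverses_def)
  qed
qed

section \<open>Commuting with a contraction of finite order\<close>

text \<open>If \<open>f\<close> moves points at all, some \<open>f\<^sup>m\<close> moves a point beyond its \<open>K\<close>-image; by commutation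
  this persists along the \<open>K\<close>-orbit, which tends to \<open>0\<close>, where \<open>f\<close> is closer to the identity than
  \<open>K\<close>.\<close>

lemma commuting_flat_aux:
  fixes f K :: "real \<Rightarrow> real"
  assumes K: "strict_mono K" "continuous_on UNIV K" "K 0 = 0" "\<And>x. 0 < x \<Longrightarrow> x \<le> q \<Longrightarrow> K x < x"
    and f: "strict_mono f" "continuous_on UNIV f" "f 0 = 0" "\<And>x. 0 < x \<Longrightarrow> x \<le> q \<Longrightarrow> f x < x"
    and comm: "\<And>x. f (K x) = K (f x)" and q: "q > 0"
    and c: "c > 0" "d > 0" "\<And>x. 0 < x \<Longrightarrow> x < d \<Longrightarrow> c * x ^ r \<le> x - K x"
    and small: "\<And>e. e > 0 \<Longrightarrow> \<exists>d>0. \<forall>x. 0 < x \<and> x < d \<longrightarrow> \<bar>f x - x\<bar> \<le> e * x ^ r"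
  shows False
proof -
  have bK: "0 < (K ^^ n) x \<and> (K ^^ n) x \<le> x" if "0 < x" "x \<le> q" for n x
    using funpow_contraction_bounds[of K 0 q x n] K(1,3,4) that by blast
  have bf: "0 < (f ^^ n) x \<and> (f ^^ n) x \<le> x" if "0 < x" "x \<le> q" for n x
    using funpow_contraction_bounds[of f 0 q x n] f(1,3,4) that by blast
  have "(\<lambda>n. (f ^^ n) q) \<longlonglongrightarrow> 0"
    using funpow_contraction_tendsto[of f 0 q q] f q by simp
  moreover have "0 < K q"
    using bK[OF q order.refl, of 1] by simp
  ultimately have "\<forall>\<^sub>F m in sequentially. (f ^^ m) q < K q"
    using order_tendstoD(2) by blast
  then obtain m where m: "(f ^^ m) q < K q"
    using eventually_happens'[OF sequentially_bot] by blast
  \<comment> \<open>The share \<open>c / (m + 1)\<close> keeps the total displacement of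
    \<open>m\<close> steps at most \<open>c x^r\<close>, hence at most
    \<open>x - K x\<close>.\<close>
  obtain \<delta> where \<delta>: "\<delta> > 0" "\<And>x. 0 < x \<Longrightarrow> x < \<delta> \<Longrightarrow> \<bar>f x - x\<bar> \<le> c / (of_nat m + 1) * x ^ r"
    using small[of "c / (of_nat m + 1)"] c(1) by (auto simp: add_pos_nonneg)
  have "(\<lambda>n. (K ^^ n) q) \<longlonglongrightarrow> 0"
    using funpow_contraction_tendsto[of K 0 q q] K q by simp
  then have "\<forall>\<^sub>F n in sequentially. (K ^^ n) q < min d \<delta>"
    using c \<delta> by (intro order_tendstoD(2)) auto
  then obtain n where n: "(K ^^ n) q < min d \<delta>"
    using eventually_happens'[OF sequentially_bot] by blast
  define x where "x = (K ^^ n) q"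
  have x: "0 < x" "x \<le> q" "x < d" "x < \<delta>"
    using bK[OF q order.refl, of n] n by (auto simp: x_def)
  \<comment> \<open>Commutation transports \<open>f^m q < K q\<close> to the point
    \<open>x = K^n q\<close>.\<close>
  have "(f ^^ m) x = (K ^^ n) ((f ^^ m) q)"
    unfolding x_def by (rule funpow_commute) (rule funpow_commute[symmetric], rule comm[symmetric])
  also have "\<dots> < (K ^^ n) (K q)"
    using m strict_mono_funpow[OF K(1)] by (simp add: strict_mono_def)
  also have "\<dots> = K x"
    by (simp add: x_def funpow_swap1)
  finally have "(f ^^ m) x < K x" .
  moreover have "x - (f ^^ m) x \<le> of_nat m * (c / (of_nat m + 1) * x ^ r)"
  proof -
    have "(f ^^ j) x - (f ^^ Suc j) x \<le> c / (of_nat m + 1) * x ^ r" for j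
    proof -
      have y: "0 < (f ^^ j) x" "(f ^^ j) x \<le> x"
        using bf[OF x(1,2), of j] by auto
      then have "(f ^^ j) x - (f ^^ Suc j) x \<le> c / (of_nat m + 1) * ((f ^^ j) x) ^ r"
        using \<delta>(2)[of "(f ^^ j) x"] x by auto
      also have "\<dots> \<le> c / (of_nat m + 1) * x ^ r"
        using y c(1) by (intro mult_left_mono power_mono) auto
      finally show ?thesis .
    qed
    then have "(\<Sum>j<m. (f ^^ j) x - (f ^^ Suc j) x) \<le> (\<Sum>j<m. c / (of_nat m + 1) * x ^ r)"
      by (intro sum_mono)
    then show ?thesis
      unfolding sum_lessThan_telescope'[of "\<lambda>j. (f ^^ j) x"] by simp
  qed
  moreover have "of_nat m * (c / (of_nat m + 1) * x ^ r) \<le> c * x ^ r"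
    using c(1) x(1) by (simp add: field_simps)
  ultimately show False
    using c(3)[OF x(1,3)] by simp
qed

text \<open>By Kopell's lemma a single fixed point of \<open>f\<close> in \<open>(0, q]\<close>
  forces the identity. Otherwise \<open>f\<close> stays on one side of the identity there, and the
  orbit comparison applies to \<open>f\<close> or to its inverse \<open>k\<close>, which satisfies
  the same smallness condition since \<open>0 < k x < x\<close>.\<close>

lemma commuting_flat_identity:
  assumes K: "diffeomorphism K" "strict_mono K" "K 0 = 0" "\<And>x. 0 < x \<Longrightarrow> x \<le> q \<Longrightarrow> K x < x"
    and f: "diffeomorphism f" "strict_mono f" "f 0 = 0"
    and comm: "\<And>x. f (K x) = K (f x)"
    and c: "c > 0" "d > 0" "\<And>x. 0 < x \<Longrightarrow> x < d \<Longrightarrow> c * x ^ r \<le> x - K x"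
    and small: "\<And>e. e > 0 \<Longrightarrow> \<exists>d>0. \<forall>x. 0 < x \<and> x < d \<longrightarrow> \<bar>f x - x\<bar> \<le> e * x ^ r"
    and x: "0 \<le> x" "x \<le> q"
  shows "f x = x"
proof (rule ccontr)
  assume ne: "f x \<noteq> x"
  note contK = smooth_continuous_on[OF diffeomorphism_smooth[OF K(1)]]
  note contf = smooth_continuous_on[OF diffeomorphism_smooth[OF f(1)]]
  have q: "q > 0"
    using x ne f(3) by (cases "x = 0") auto
  have nofix: "f y \<noteq> y" if "0 < y" "y \<le> q" for y
    using Kopell[OF K f(1,2) comm[symmetric] _ that x] ne by blast
  have same_side: "f y < y \<longleftrightarrow> f q < q" if y: "0 < y" "y \<le> q" for y
  proof (rule ccontr)
    assume *: "\<not> ?thesis"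
    have "continuous_on UNIV (\<lambda>y. f y - y)"
      by (intro continuous_intros contf)
    then obtain z where "y \<le> z" "z \<le> q" "f z - z = 0"
      by (rule IVT_sign_change) (use y * in auto)
    then show False
      using nofix[of z] y by auto
  qed
  show False
  proof (cases "f q < q")
    case True
    then have "f y < y" if "0 < y" "y \<le> q" for y
      using same_side that by blast
    then show False
      using commuting_flat_aux[OF K(2) contK K(3,4) f(2) contf f(3) _ comm q c small] by blast
  next
    case False
    then have up: "y < f y" if "0 < y" "y \<le> q" for y
      using same_side[OF that] nofix[OF that] by auto
    define k where "k = finv f"
    have k: "diffeomorphism k" "strict_mono k"
      using f diffeomorphism_inv strict_mono_inv_diffeomorphism by (auto simp: k_def)
    have fk [simp]: "f (k x) = x" "k (f x) = x" for x
      using f by (auto simp: k_def)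
    have k0: "k 0 = 0"
      using fk(2)[of 0] f(3) by simp
    have kpos: "0 < k y" if "0 < y" for y
      using strict_mono_less[OF k(2), of 0 y] that k0 by simp
    have down: "k y < y" if y: "0 < y" "y \<le> q" for y
    proof (rule ccontr)
      assume "\<not> k y < y"
      then have "y \<le> k y" by simp
      then have "f y \<le> y"
        using strict_mono_less_eq[OF f(2), of y "k y"] by simp
      with up[OF y] show False by simp
    qed
    have "\<exists>d>0. \<forall>x. 0 < x \<and> x < d \<longrightarrow> \<bar>k x - x\<bar> \<le> e * x ^ r" if "e > 0" for e
    proof -
      obtain d where d: "d > 0" "\<And>x. 0 < x \<Longrightarrow> x < d \<Longrightarrow> \<bar>f x - x\<bar> \<le> e * x ^ r"
        using small[OF \<open>e > 0\<close>] by blast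
      have "\<bar>k x - x\<bar> \<le> e * x ^ r" if x: "0 < x" "x < min d q" for x
      proof -
        have kx: "0 < k x" "k x < x"
          using kpos[OF x(1)] down[of x] x by auto
        have "\<bar>k x - x\<bar> = \<bar>f (k x) - k x\<bar>"
          by simp
        also have "\<dots> \<le> e * k x ^ r"
          using kx x by (intro d(2)) auto
        also have "\<dots> \<le> e * x ^ r"
          using kx \<open>e > 0\<close> by (intro mult_left_mono power_mono) auto
        finally show ?thesis .
      qed
      then show ?thesis
        using d(1) q by (intro exI[of _ "min d q"]) auto
    qed
    moreover have "k (K x) = K (k x)" for x
      by (metis comm fk)
    moreover have "continuous_on UNIV k"
      by (rule smooth_continuous_on[OF diffeomorphism_smooth[OF k(1)]])
    ultimately show False
      using commuting_flat_aux[OF K(2) contK K(3,4) k(2) _ k0 down _ q c] by blast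
  qed
qed

section \<open>Reversed maps that agree with the identity to infinite order at
  \<open>0\<close>\<close>

lemma strict_antimono_comp_strict_mono:
  fixes h :: "real \<Rightarrow> real"
  assumes "strict_antimono_on UNIV h"
  shows "strict_mono (\<lambda>x. h (h x))"
  using assms by (auto simp: strict_mono_def monotone_def)

lemma strict_antimono_leD:
  fixes h :: "real \<Rightarrow> real"
  shows "strict_antimono_on UNIV h \<Longrightarrow> x \<le> y \<Longrightarrow> h y \<le> h x"
  using monotoneD[of "(<)" "\<lambda>x y. y < x" h x y] by (cases "x = y") auto

lemma eventually_at_0_imp_right:
  assumes "\<forall>\<^sub>F x in at (0::real). P x"
  shows "\<exists>d>0. \<forall>x. 0 < x \<and> x < d \<longrightarrow> P x"
proof -
  obtain d where "d > 0" "\<forall>x. x \<noteq> 0 \<and> dist x 0 < d \<longrightarrow> P x"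
    using assms by (auto simp: eventually_at)
  then show ?thesis
    by (intro exI[of _ d]) (auto simp: dist_real_def)
qed

text \<open>A negative leading coefficient makes \<open>h^2\<close> a contraction right of
  \<open>0\<close> with \<open>x - h (h x)\<close> at least a multiple of \<open>x ^ r\<close>,
  while \<open>f - id\<close> is of smaller order than every power.\<close>

lemma flat_reversed_contraction:
  assumes f: "diffeomorphism f" "strict_mono f" "f 0 = 0" and fl: "flat (\<lambda>x. f x - x)"
    and h: "diffeomorphism h" "strict_antimono_on UNIV h" "h 0 = 0"
    and rev: "\<And>x. f (h (f x)) = h x"
    and lead: "((\<lambda>x. (h (h x) - x) / x ^ r) \<longlongrightarrow> b) (at 0)" "b < 0"
  shows "\<exists>q>0. \<forall>x. 0 \<le> x \<and> x \<le> q \<longrightarrow> f x = x"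
proof -
  have "\<forall>\<^sub>F x in at 0. (h (h x) - x) / x ^ r < b / 2"
    using lead by (intro order_tendstoD(2)) auto
  then obtain d where d: "d > 0" "\<And>x. 0 < x \<Longrightarrow> x < d \<Longrightarrow> (h (h x) - x) / x ^ r < b / 2"
    using eventually_at_0_imp_right by blast
  have lower: "- (b / 2) * x ^ r \<le> x - h (h x)" if "0 < x" "x < d" for x
    using d(2)[OF that] that by (simp add: pos_divide_less_eq)
  have contr: "h (h x) < x" if "0 < x" "x \<le> d / 2" for x
  proof -
    have "- (b / 2) * x ^ r > 0"
      using lead(2) that by (simp add: mult_neg_pos)
    moreover have "x < d"
      using d(1) that by simp
    ultimately show ?thesis
      using lower[OF that(1)] by simp
  qed
  have small: "\<exists>d>0. \<forall>x. 0 < x \<and> x < d \<longrightarrow> \<bar>f x - x\<bar> \<le> e * x ^ r" if "e > 0" for e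
  proof -
    have "((\<lambda>x. (f x - x) / x ^ r) \<longlongrightarrow> 0) (at 0)"
      by (intro flat_tendsto fl smooth_diff diffeomorphism_smooth f smooth_ident)
    then have "\<forall>\<^sub>F x in at 0. \<bar>(f x - x) / x ^ r\<bar> < e"
      using that order_tendstoD(2)[OF tendsto_rabs_zero] by blast
    then obtain d where "d > 0" "\<And>x. 0 < x \<Longrightarrow> x < d \<Longrightarrow> \<bar>(f x - x) / x ^ r\<bar> < e"
      using eventually_at_0_imp_right by blast
    then show ?thesis
      by (intro exI[of _ d]) (auto simp: abs_divide pos_divide_less_eq less_imp_le)
  qed
  \<comment> \<open>\<open>- (b / 2)\<close> is half the limit of
    \<open>(x - h (h x)) / x ^ r\<close>, and \<open>d / 2\<close> keeps the closed interval within
    the range of the estimate.\<close>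
  have "f x = x" if "0 \<le> x" "x \<le> d / 2" for x
    by (rule commuting_flat_identity[where K = "\<lambda>x. h (h x)" and q = "d / 2" and c = "- (b / 2)"
        and d = d and r = r])
      (use that d(1) lead(2) lower contr small h f reversal_commutes[of f h, OF f(1) rev] in
        \<open>auto intro: diffeomorphism_comp' strict_antimono_comp_strict_mono\<close>)
  then show ?thesis
    using d(1) by (intro exI[of _ "d / 2"]) auto
qed

text \<open>If neither leading coefficient is negative, \<open>h^2\<close> and its inverse both move
  small positive points to the right, which is absurd; so one of them contracts.\<close>

lemma flat_reversed_identity_near_0:
  assumes f: "diffeomorphism f" "strict_mono f" "f 0 = 0" and fl: "flat (\<lambda>x. f x - x)"
    and h: "diffeomorphism h" "strict_antimono_on UNIV h" "h 0 = 0"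
    and rev: "\<And>x. f (h (f x)) = h x"
    and nk: "\<not> flat (\<lambda>x. h (h x) - x)" and nk': "\<not> flat (\<lambda>x. finv h (finv h x) - x)"
  shows "\<exists>q>0. \<forall>x. 0 \<le> x \<and> x \<le> q \<longrightarrow> f x = x"
proof -
  define g where "g = finv h"
  have g: "diffeomorphism g" "strict_antimono_on UNIV g"
    using h diffeomorphism_inv strict_antimono_inv_diffeomorphism by (auto simp: g_def)
  have g0: "g 0 = 0"
    using diffeomorphism_inv_f[OF h(1), of 0] h(3) by (simp add: g_def)
  have revg: "f (g (f x)) = g x" for x
    unfolding g_def by (rule reversal_inv[OF f(1) h(1) rev])
  have sh: "smooth (\<lambda>x. h (h x) - x)" and sg: "smooth (\<lambda>x. g (g x) - x)"
    using h g diffeomorphism_smooth[OF diffeomorphism_comp'] by (auto intro!: smooth_diff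
        smooth_ident)
  obtain r b where b: "b \<noteq> 0" "((\<lambda>x. (h (h x) - x) / x ^ r) \<longlongrightarrow> b) (at 0)"
    by (rule nonflat_leading_term[OF sh nk]) (use h in auto)
  obtain s c where c: "c \<noteq> 0" "((\<lambda>x. (g (g x) - x) / x ^ s) \<longlongrightarrow> c) (at 0)"
    by (rule nonflat_leading_term[OF sg]) (use nk' g0 in \<open>auto simp: g_def\<close>)
  show ?thesis
  proof (cases "b < 0 \<or> c < 0")
    case True
    then show ?thesis
      using flat_reversed_contraction[OF f fl h rev b(2)]
        flat_reversed_contraction[OF f fl g g0 revg c(2)] by blast
  next
    case False
    then have "\<forall>\<^sub>F x in at 0. 0 < (h (h x) - x) / x ^ r" "\<forall>\<^sub>F x in at 0. 0 < (g (g x) - x) / x ^ s"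
      using b c by (auto intro!: order_tendstoD(1))
    then have "\<forall>\<^sub>F x in at 0. 0 < (h (h x) - x) / x ^ r \<and> 0 < (g (g x) - x) / x ^ s"
      by (rule eventually_conj)
    then obtain d where d: "d > 0"
      "\<And>x. 0 < x \<Longrightarrow> x < d \<Longrightarrow> 0 < (h (h x) - x) / x ^ r \<and> 0 < (g (g x) - x) / x ^ s"
      using eventually_at_0_imp_right by blast
    define x where "x = d / 2"
    have "x < h (h x)" "x < g (g x)"
      using d(1) d(2)[of x] by (auto simp: x_def zero_less_divide_iff not_less[symmetric])
    moreover have "h (h (g (g x))) = x"
      using h(1) by (simp add: g_def)
    ultimately have False
      using strict_monoD[OF strict_antimono_comp_strict_mono[OF h(2)], of x "g (g x)"] by simp
    then show ?thesis ..
  qed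
qed

section \<open>Involutions obtained by gluing\<close>

text \<open>Both \<open>h\<close> and its inverse exchange the half-lines, so \<open>t\<close> is an
  involution. On each side \<open>f t f = t\<close> is inherited from \<open>h\<close> or its
  inverse; when \<open>0\<close> separates \<open>x\<close> from \<open>f x\<close>,
  \<open>cross\<close> makes \<open>h\<close> and its inverse agree at \<open>f x\<close>.\<close>

lemma involution_reverses_glue:
  assumes f: "diffeomorphism f" and h: "diffeomorphism h" "strict_antimono_on UNIV h" "h 0 = 0"
    and rev: "\<And>x. f (h (f x)) = h x" and fl: "flat (\<lambda>x. h (h x) - x)"
    and cross: "\<And>x. (0 \<le> x \<longleftrightarrow> 0 \<le> f x) \<or> h (f x) = finv h (f x)"
  shows "involution_reverses f"
proof -
  note sh = diffeomorphism_smooth[OF h(1)] and si = diffeomorphism_smooth[OF diffeomorphism_inv[OF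
      h(1)]]
  have hi [simp]: "h (finv h x) = x" "finv h (h x) = x" for x
    using h(1) by auto
  have i0: "finv h 0 = 0"
    using hi(2)[of 0] h(3) by simp
  have hneg: "h x \<le> 0" if "0 \<le> x" for x
    using strict_antimono_leD[OF h(2) that] h(3) by simp
  have ipos: "0 < finv h x" if "x < 0" for x
    using that i0 monotoneD[OF strict_antimono_inv_diffeomorphism[OF h(1,2)], of x 0] by auto
  \<comment> \<open>Written as \<open>finv h\<close> plus a flat function replaced by
    \<open>0\<close> on the left, \<open>t\<close> is visibly smooth.\<close>
  define t where "t x = finv h x + (if 0 \<le> x then h x - finv h x else 0)" for x
  have t: "t x = (if 0 \<le> x then h x else finv h x)" for x
    by (simp add: t_def)
  have "smooth t"
    unfolding t_def by (intro smooth_add si smooth_glue_zero smooth_diff sh flat_diff_inv h fl)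
  moreover have "t (t x) = x" for x
  proof (cases "0 \<le> x")
    case True
    show ?thesis
    proof (cases "h x = 0")
      case True
      then have "x = 0" using hi(2)[of x] i0 by simp
      then show ?thesis using h(3) by (simp add: t)
    next
      case False
      then show ?thesis using hneg[OF True] True by (simp add: t)
    qed
  next
    case False
    then show ?thesis using ipos[of x] by (simp add: t)
  qed
  moreover have "f (t (f x)) = t x" for x
    using cross[of x] rev[of x] reversal_inv[OF f h(1) rev, of x] by (auto simp: t)
  ultimately show ?thesis
    by (auto simp: involution_reverses_def)
qed

text \<open>The involution is \<open>\<phi>\<^sup>-\<^sup>1 (- \<phi>)\<close>, where \<open>\<phi>\<close> is linear near \<open>0\<close>, the identity on the far right
  and \<open>- h\<^sup>-\<^sup>1\<close> on the far left; thus it agrees with \<open>h\<close> or \<open>h\<^sup>-\<^sup>1\<close> wherever \<open>f\<close> is not the identity.\<close>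

lemma involution_reverses_identity_near_0:
  assumes f: "diffeomorphism f" "strict_mono f"
    and h: "diffeomorphism h" "strict_antimono_on UNIV h" "h 0 = 0"
    and rev: "\<And>x. f (h (f x)) = h x"
    and e: "e > 0" "\<And>x. 0 \<le> x \<Longrightarrow> x \<le> e \<Longrightarrow> f x = x"
  shows "involution_reverses f"
proof -
  define i where "i = finv h"
  have i: "diffeomorphism i" "strict_antimono_on UNIV i"
    using h diffeomorphism_inv strict_antimono_inv_diffeomorphism by (auto simp: i_def)
  have hi [simp]: "h (i x) = x" "i (h x) = x" for x
    using h(1) by (auto simp: i_def)
  have revi: "f (i (f x)) = i x" for x
    unfolding i_def by (rule reversal_inv[OF f(1) h(1) rev])
  have i0: "i 0 = 0"
    using hi(2)[of 0] h(3) by simp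
  have he: "h e < 0"
    using monotoneD[OF h(2), of 0 e] e h by simp
  \<comment> \<open>The choice puts \<open>[- d, d]\<close> inside \<open>[h e, e]\<close>, an
    interval on which \<open>f\<close> is the identity.\<close>
  define d where "d = min e (- h e)"
  have d: "0 < d" "d \<le> e" "h e \<le> - d"
    using e he by (auto simp: d_def)
  \<comment> \<open>A point of \<open>[h e, 0]\<close> is the image under \<open>h\<close> of a
    fixed point of \<open>f\<close> in \<open>[0, e]\<close>.\<close>
  have fix_left: "f x = x" if "h e \<le> x" "x \<le> 0" for x
  proof -
    have "0 \<le> i x" "i x \<le> e"
      using strict_antimono_leD[OF i(2) that(2)] strict_antimono_leD[OF i(2) that(1)] i0 by auto
    then have "f (i x) = i x"
      by (rule e(2))
    then show ?thesis
      using rev[of "i x"] by simp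
  qed
  have "d / 2 < d"
    using d(1) by simp
  then obtain X where X: "smooth X" "\<And>x. x \<le> d / 2 \<Longrightarrow> X x = 0" "\<And>x. d \<le> x \<Longrightarrow> X x = 1" "\<And>x. deriv X x
      \<ge> 0"
      "\<And>x. d / 2 < x \<Longrightarrow> x < d \<Longrightarrow> deriv X x > 0"
    using smooth_step by blast
  have dX0: "deriv X x = 0" if "x < d / 2 \<or> d < x" for x
  proof -
    have "\<exists>c. \<forall>\<^sub>F y in nhds x. X y = c"
      using that
    proof
      assume "x < d / 2"
      then have "\<forall>\<^sub>F y in nhds x. y \<in> {..<d / 2}" by (intro eventually_nhds_in_open) auto
      then show ?thesis using X(2) by (auto elim!: eventually_mono)
    next
      assume "d < x"
      then have "\<forall>\<^sub>F y in nhds x. y \<in> {d<..}" by (intro eventually_nhds_in_open) auto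
      then show ?thesis using X(3) by (auto elim!: eventually_mono)
    qed
    then obtain c where "\<forall>\<^sub>F y in nhds x. X y = c" ..
    then have "deriv X x = deriv (\<lambda>_. c) x"
      by (rule deriv_cong_ev) simp
    then show ?thesis by simp
  qed
  have X01: "0 \<le> X x" "X x \<le> 1" for x
  proof -
    have mono: "X x \<le> X y" if "x \<le> y" for x y
      using that deriv_nonneg_imp_mono[of x y X "deriv X"] X(1,4) smooth_DERIV by blast
    show "0 \<le> X x" using mono[of "min x 0" x] X(2)[of "min x 0"] d(1) by auto
    show "X x \<le> 1" using mono[of x "max x d"] X(3)[of "max x d"] by auto
  qed
  \<comment> \<open>The bound \<open>1 / 2\<close> ensures \<open>c < 1\<close>; the other makes
    \<open>c * x + i x\<close> nonnegative on the left transition zone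
    \<open>[- d, - d / 2]\<close>.\<close>
  define c where "c = min (1 / 2) (i (- (d / 2)) / d)"
  have c: "0 < c" "c < 1" "c * d \<le> i (- (d / 2))"
    using monotoneD[OF i(2), of "- (d / 2)" 0] i0 d(1) by (auto simp: c_def min_def field_simps)
  \<comment> \<open>\<open>X x\<close> switches from \<open>c * x\<close> to the identity on the
    right, \<open>X (- x)\<close> to \<open>- i x\<close> on the left.\<close>
  define \<phi> where "\<phi> x = c * x + X x * (x - c * x) + X (- x) * (- i x - c * x)" for x
  have si: "smooth i" by (rule diffeomorphism_smooth[OF i(1)])
  have s\<phi>: "smooth \<phi>"
    unfolding \<phi>_def
    by (intro smooth_add smooth_mult smooth_diff smooth_minus smooth_const smooth_ident X(1) si
        smooth_comp[OF X(1) smooth_minus[OF smooth_ident]])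
  have D\<phi>: "(\<phi> has_real_derivative (c * (1 - X x - X (- x)) + X x - X (- x) * deriv i x
      + deriv X x * ((1 - c) * x) + deriv X (- x) * (c * x + i x))) (at x)" for x
    unfolding \<phi>_def
    by (auto intro!: derivative_eq_intros smooth_DERIV[OF si] smooth_DERIV[OF X(1)]
        DERIV_chain2[OF smooth_DERIV[OF X(1)]] simp: algebra_simps)
  have d\<phi>: "deriv \<phi> x > 0" for x
  proof -
    note di = diffeomorphism_deriv_neg[OF i, of x]
    \<comment> \<open>Up to nonnegative terms with \<open>deriv X\<close>, the derivative of
      \<open>\<phi>\<close> is a convex combination of \<open>c\<close> and of \<open>1\<close> or
      \<open>- deriv i x\<close>.\<close>
    have convex: "c * (1 - s) + s * w > 0" if "0 \<le> s" "s \<le> 1" "w > 0" for s w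
      using that c by (cases "s = 1") (auto intro: add_pos_nonneg)
    show ?thesis
    proof (cases "0 \<le> x")
      case True
      then have "X (- x) = 0" "deriv X (- x) = 0"
        using d(1) X(2) dX0 by auto
      moreover have "deriv X x * ((1 - c) * x) \<ge> 0"
        using True c X(4) by simp
      ultimately show ?thesis
        using DERIV_imp_deriv[OF D\<phi>, of x] convex[OF X01, of 1 x] by simp
    next
      case False
      then have "X x = 0" "deriv X x = 0"
        using d(1) X(2) dX0 by auto
      moreover have "deriv X (- x) * (c * x + i x) \<ge> 0"
      proof (cases "- x < d / 2 \<or> d < - x")
        case True
        then show ?thesis by (simp add: dX0)
      next
        case False
        then have "c * x \<ge> c * - d"
          using c by (intro mult_left_mono) auto
        moreover have "i x \<ge> i (- (d / 2))"
          using False by (intro strict_antimono_leD[OF i(2)]) auto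
        ultimately show ?thesis
          using X(4) c(3) by simp
      qed
      ultimately show ?thesis
        using DERIV_imp_deriv[OF D\<phi>, of x] convex[OF X01, of "- deriv i x" "- x"] di by simp
    qed
  qed
  have \<phi>_right: "\<phi> x = x" if "d \<le> x" for x
    using that d(1) X(2)[of "- x"] X(3)[of x] by (simp add: \<phi>_def)
  have \<phi>_left: "\<phi> x = - i x" if "x \<le> - d" for x
    using that d(1) X(2)[of x] X(3)[of "- x"] by (simp add: \<phi>_def)
  have "\<exists>x. y = \<phi> x" for y
  proof -
    \<comment> \<open>\<open>i\<close> takes the value \<open>- y\<close> at \<open>h (- y)\<close>,
      so \<open>\<phi> a = - i a\<close> is at most \<open>y\<close>.\<close>
    define a where "a = min (- d) (h (- y))"
    have "i (h (- y)) \<le> i a"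
      by (rule strict_antimono_leD[OF i(2)]) (simp add: a_def)
    then have "\<phi> a \<le> y"
      using \<phi>_left[of a] by (simp add: a_def)
    moreover have "y \<le> \<phi> (max d y)" "a \<le> max d y"
      using \<phi>_right[of "max d y"] d(1) by (auto simp: a_def)
    ultimately show ?thesis
      using IVT'[of \<phi> a y "max d y", OF _ _ _ smooth_continuous_on[OF s\<phi>]] by metis
  qed
  then have \<phi>: "diffeomorphism \<phi>"
    by (intro diffeomorphismI s\<phi> d\<phi>) (simp add: surj_def)
  have "strict_mono \<phi>"
    using DERIV_pos_imp_increasing d\<phi> smooth_DERIV[OF s\<phi>] by (metis strict_mono_def)
  define t where "t x = finv \<phi> (- \<phi> x)" for x
  have \<phi>t: "\<phi> (t x) = - \<phi> x" and tt: "t (t x) = x" for x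
    using \<phi> by (auto simp: t_def)
  have t_eq: "t x = y" if "\<phi> y = - \<phi> x" for x y
    unfolding t_def that[symmetric] using \<phi> by simp
  have t_right: "t x = h x" if "e \<le> x" for x
  proof (rule t_eq)
    have "h x \<le> h e"
      by (rule strict_antimono_leD[OF h(2) that])
    then show "\<phi> (h x) = - \<phi> x"
      using \<phi>_right[of x] \<phi>_left[of "h x"] that d by simp
  qed
  have t_left: "t x = i x" if "x \<le> h e" for x
  proof (rule t_eq)
    have "e \<le> i x"
      using strict_antimono_leD[OF i(2) that] by simp
    then show "\<phi> (i x) = - \<phi> x"
      using \<phi>_right[of "i x"] \<phi>_left[of x] that d by simp
  qed
  have "f (t (f x)) = t x" for x
  proof -
    \<comment> \<open>The two outer rays are invariant under \<open>f\<close>, and there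
      \<open>t\<close> is \<open>h\<close> or its inverse; the middle interval is pointwise fixed by
      \<open>f\<close> and invariant under \<open>t\<close>.\<close>
    consider "e \<le> x" | "x \<le> h e" | "h e \<le> x" "x \<le> e" by linarith
    then show ?thesis
    proof cases
      case 1
      then have "e \<le> f x"
        using strict_mono_less_eq[OF f(2), of e x] e by simp
      then show ?thesis using 1 rev by (simp add: t_right)
    next
      case 2
      then have "f x \<le> h e"
        using strict_mono_less_eq[OF f(2), of x "h e"] fix_left[of "h e"] he by simp
      then show ?thesis using 2 revi by (simp add: t_left)
    next
      case 3
      have "\<phi> (h e) \<le> \<phi> x" "\<phi> x \<le> \<phi> e"
        using 3 strict_mono_less_eq[OF \<open>strict_mono \<phi>\<close>] by auto
      then have "\<phi> (t e) \<le> \<phi> (t x)" "\<phi> (t x) \<le> \<phi> (t (h e))"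
        by (auto simp: \<phi>t)
      then have "h e \<le> t x" "t x \<le> e"
        using strict_mono_less_eq[OF \<open>strict_mono \<phi>\<close>] t_right[of e] t_left[of "h e"] by auto
      then have "f (t x) = t x"
        using e(2) fix_left by (cases "0 \<le> t x") auto
      moreover have "f x = x"
        using 3 e(2) fix_left by (cases "0 \<le> x") auto
      ultimately show ?thesis by simp
    qed
  qed
  moreover have "smooth t"
    unfolding t_def
    by (rule smooth_comp[OF diffeomorphism_smooth[OF diffeomorphism_inv[OF \<phi>]] smooth_minus[OF s\<phi>]])
  ultimately show ?thesis
    using tt by (auto simp: involution_reverses_def)
qed

section \<open>Reversal by an increasing diffeomorphism with a fixed point\<close>

text \<open>\<open>h^2\<close> commutes with \<open>g\<close> and contracts \<open>(p, c]\<close>,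
  where \<open>p\<close> is the largest fixed point of \<open>h\<close> below \<open>c\<close>. The
  relation makes \<open>g - id\<close> change sign between \<open>h c\<close> and \<open>c\<close>,
  so \<open>g\<close> has a fixed point there and Kopell's lemma applies.\<close>

lemma reversed_by_increasing_aux:
  assumes g: "diffeomorphism g" "strict_mono g" and h: "diffeomorphism h" "strict_mono h" "h p0 =
      p0"
    and rev: "\<And>x. g (h (g x)) = h x" and c: "p0 \<le> c" "h c < c"
  shows "g c = c"
proof (rule ccontr)
  assume ne: "g c \<noteq> c"
  have fixed: "g y = y" if "h y = y" for y
  proof (rule linorder_cases[of "g y" y])
    assume "g y < y"
    then have "g (h (g y)) < g (h y)"
      using g(2) h(2) by (simp add: strict_mono_def)
    then show ?thesis using rev[of y] that \<open>g y < y\<close> by simp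
  next
    assume "y < g y"
    then have "g (h y) < g (h (g y))"
      using g(2) h(2) by (simp add: strict_mono_def)
    then show ?thesis using rev[of y] that \<open>y < g y\<close> by simp
  qed
  have conth: "continuous_on UNIV h" and contg: "continuous_on UNIV g"
    using g h smooth_continuous_on diffeomorphism_smooth by blast+
  obtain p where p: "p0 \<le> p" "p < c" "h p = p" "\<And>x. p < x \<Longrightarrow> x \<le> c \<Longrightarrow> h x < x"
    using greatest_fixed_point_below[OF conth h(3) c] by blast
  have K: "diffeomorphism (\<lambda>x. h (h x))" "strict_mono (\<lambda>x. h (h x))"
    using h diffeomorphism_comp' by (auto simp: strict_mono_def)
  have contr: "h (h x) < x" if "p < x" "x \<le> c" for x
  proof -
    have "h x < x" using p(4) that by blast
    moreover have "h (h x) < h x" using calculation h(2) by (simp add: strict_mono_def)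
    ultimately show ?thesis by simp
  qed
  have hc: "p < h c"
    using strict_mono_less[OF h(2), of p c] p by simp
  have "g c < c \<Longrightarrow> h c < g (h c)"
    using rev[of c] strict_monoD[OF h(2), of "g c" c] strict_monoD[OF g(2), of "h (g c)" "h c"] by
        simp
  moreover have "c < g c \<Longrightarrow> g (h c) < h c"
    using rev[of c] strict_monoD[OF h(2), of c "g c"] strict_monoD[OF g(2), of "h c" "h (g c)"] by
        simp
  ultimately have sign: "g (h c) - h c \<le> 0 \<and> 0 \<le> g c - c \<or> g c - c \<le> 0 \<and> 0 \<le> g (h c) - h c"
    using ne by linarith
  have "continuous_on UNIV (\<lambda>x. g x - x)"
    by (intro continuous_intros contg)
  then obtain z where z: "h c \<le> z" "z \<le> c" "g z - z = 0"
    by (rule IVT_sign_change[OF _ less_imp_le[OF c(2)] sign])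
  have "g c = c"
    by (rule Kopell[OF K _ contr g, where p = p and c = c and z = z])
      (use p z hc reversal_commutes[of g h, OF g(1) rev] in auto)
  with ne show False ..
qed

text \<open>A point that \<open>h\<close> moves down is the previous case; one that it moves up is
  treated with the inverse of \<open>h\<close>, one that it fixes by monotonicity alone. Points left
  of \<open>p0\<close> are reached by conjugating with \<open>x -> - x\<close>.\<close>

lemma reversed_by_increasing:
  assumes g: "diffeomorphism g" "strict_mono g" and h: "diffeomorphism h" "strict_mono h" "h p0 =
      p0"
    and rev: "\<And>x. g (h (g x)) = h x"
  shows "g x = x"
proof -
  have right: "k c = c"
    if k: "diffeomorphism k" "strict_mono k" and l: "diffeomorphism l" "strict_mono l" "l q = q"
      and revk: "\<And>x. k (l (k x)) = l x" and c: "q \<le> c" for k l q c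
  proof (rule linorder_cases[of "l c" c])
    assume "l c < c"
    then show ?thesis by (rule reversed_by_increasing_aux[OF k l revk c])
  next
    assume eq: "l c = c"
    show ?thesis
    proof (rule linorder_cases[of "k c" c])
      assume "k c < c"
      then have "k (l (k c)) < k (l c)"
        using k(2) l(2) by (simp add: strict_mono_def)
      then show ?thesis using revk[of c] eq \<open>k c < c\<close> by simp
    next
      assume "c < k c"
      then have "k (l c) < k (l (k c))"
        using k(2) l(2) by (simp add: strict_mono_def)
      then show ?thesis using revk[of c] eq \<open>c < k c\<close> by simp
    qed
  next
    assume "c < l c"
    then have "finv l c < c"
      using strict_mono_less[OF l(2), of "finv l c" c] l(1) by simp
    moreover have "finv l q = q"
      using l(1,3) by (metis diffeomorphism_inv_f)
    ultimately show ?thesis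
      using reversed_by_increasing_aux[OF k diffeomorphism_inv[OF l(1)]
          strict_mono_inv_diffeomorphism[OF l(1,2)] _ reversal_inv[OF k(1) l(1) revk] c] by blast
  qed
  have neg: "diffeomorphism (\<lambda>x::real. - x)"
    by (rule diffeomorphism_involution) (auto intro: smooth_intros)
  show ?thesis
  proof (cases "p0 \<le> x")
    case True
    then show ?thesis using right[OF g h rev] by blast
  next
    case False
    have conj: "diffeomorphism (\<lambda>x. - k (- x)) \<and> strict_mono (\<lambda>x. - k (- x))"
      if "diffeomorphism k" "strict_mono k" for k
      using that diffeomorphism_comp'[OF neg diffeomorphism_comp'[OF that(1) neg]]
      by (auto simp: strict_mono_def)
    have "- g (- (- x)) = - x"
      by (rule right[of "\<lambda>x. - g (- x)" "\<lambda>x. - h (- x)" "- p0"])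
        (use conj[OF g] conj[OF h(1,2)] h(3) rev False in auto)
    then show ?thesis by simp
  qed
qed

section \<open>Decreasing diffeomorphisms\<close>

lemma strict_antimono_fixed_point:
  fixes f :: "real \<Rightarrow> real"
  assumes cont: "continuous_on UNIV f" and f: "strict_antimono_on UNIV f"
  obtains p where "f p = p"
proof -
  have c: "continuous_on UNIV (\<lambda>x. f x - x)"
    by (intro continuous_intros cont)
  show ?thesis
  \<comment> \<open>\<open>f x - x\<close> has weakly opposite signs at \<open>0\<close> and at
    \<open>f 0\<close>.\<close>
  proof (cases "0 \<le> f 0")
    case True
    obtain p where "f p - p = 0"
      by (rule IVT_sign_change[OF c True]) (use True strict_antimono_leD[OF f True] in auto)
    then show ?thesis using that by simp
  next
    case False
    then have le: "f 0 \<le> 0" by simp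
    obtain p where "f p - p = 0"
      by (rule IVT_sign_change[OF c le]) (use le strict_antimono_leD[OF f le] in auto)
    then show ?thesis using that by simp
  qed
qed

lemma decreasing_reversible_imp_involution:
  assumes f: "diffeomorphism f" "strict_antimono_on UNIV f" and h: "diffeomorphism h"
    and rev: "\<And>x. f (h (f x)) = h x"
  shows "f (f x) = x"
proof -
  obtain k where k: "diffeomorphism k" "strict_mono k" "\<And>x. f (k (f x)) = k x"
    using h
  proof (cases rule: diffeomorphism_mono_cases)
    case inc
    then show ?thesis using that h rev by blast
  next
    case dec
    \<comment> \<open>If \<open>h\<close> decreases, then \<open>h f\<close> increases, and it also
      reverses \<open>f\<close>.\<close>
    have "strict_mono (\<lambda>x. h (f x))"
      using dec(1) f(2) by (auto simp: strict_mono_def monotone_def)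
    then show ?thesis
      using that[of "\<lambda>x. h (f x)"] diffeomorphism_comp'[OF h f(1)] rev by blast
  qed
  obtain p where p: "f p = p"
    using strict_antimono_fixed_point[OF smooth_continuous_on[OF diffeomorphism_smooth[OF f(1)]]
        f(2)]
    by blast
  \<comment> \<open>\<open>k\<close> preserves the fixed points of \<open>f\<close>, and a
    decreasing map has only one.\<close>
  have "f (k p) = k p"
    using k(3)[of p] p by simp
  then have "k p = p"
    using p monotoneD[OF f(2), of p "k p"] monotoneD[OF f(2), of "k p" p]
    by (cases "k p" p rule: linorder_cases) auto
  show ?thesis
    by (rule reversed_by_increasing[of "\<lambda>x. f (f x)" k p])
      (use k \<open>k p = p\<close> diffeomorphism_comp'[OF f(1) f(1)] strict_antimono_comp_strict_mono[OF
          f(2)] in auto)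
qed

section \<open>Reversal of an increasing diffeomorphism by a decreasing one\<close>

lemma increasing_reversed_by_decreasing_0:
  assumes f: "diffeomorphism f" "strict_mono f"
    and h: "diffeomorphism h" "strict_antimono_on UNIV h" "h 0 = 0"
    and rev: "\<And>x. f (h (f x)) = h x"
  shows "involution_reverses f"
proof -
  define i where "i = finv h"
  have i: "diffeomorphism i" "strict_antimono_on UNIV i"
    using h diffeomorphism_inv strict_antimono_inv_diffeomorphism by (auto simp: i_def)
  have hi [simp]: "h (i x) = x" "i (h x) = x" for x
    using h(1) by (auto simp: i_def)
  have i0: "i 0 = 0"
    using hi(2)[of 0] h(3) by simp
  have revi: "f (i (f x)) = i x" for x
    unfolding i_def by (rule reversal_inv[OF f(1) h(1) rev])
  note contf = smooth_continuous_on[OF diffeomorphism_smooth[OF f(1)]]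
  consider (free) "\<And>x. f x \<noteq> x" | (moved) z where "f 0 \<noteq> 0" "f z = z" | (fixed) "f 0 = 0"
    by blast
  then show ?thesis
  proof cases
    case free
    then show ?thesis by (rule involution_reverses_if_no_fixed_points[OF f])
  next
    case fixed
    have sides: "0 \<le> f x \<longleftrightarrow> 0 \<le> x" for x
      using strict_mono_less_eq[OF f(2), of 0 x] fixed by simp
    consider "flat (\<lambda>x. h (h x) - x)" | "flat (\<lambda>x. i (i x) - x)"
      | "\<not> flat (\<lambda>x. h (h x) - x)" "\<not> flat (\<lambda>x. i (i x) - x)" by blast
    then show ?thesis
    proof cases
      case 1
      then show ?thesis
        using involution_reverses_glue[OF f(1) h rev] sides by blast
    next
      case 2
      then show ?thesis
        using involution_reverses_glue[OF f(1) i i0 revi] sides by blast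
    next
      case 3
      have "flat (\<lambda>x. f x - x)"
        using not_both_nonflat[OF f fixed h rev] 3(1) by blast
      then obtain e where "e > 0" "\<And>x. 0 \<le> x \<Longrightarrow> x \<le> e \<Longrightarrow> f x = x"
        using flat_reversed_identity_near_0[OF f fixed _ h rev 3(1)] 3(2) unfolding i_def by blast
      then show ?thesis
        by (rule involution_reverses_identity_near_0[OF f h rev])
    qed
  next
    case moved
    have h_fix: "f (h y) = h y" if "f y = y" for y
      using rev[of y] that by simp
    \<comment> \<open>\<open>h\<close> maps fixed points of \<open>f\<close> to fixed points and
      exchanges the half-lines, so one of them lies left of \<open>0\<close>.\<close>
    obtain p0 where p0: "f p0 = p0" "p0 < 0"
    proof (cases z "0 :: real" rule: linorder_cases)
      case less
      then show ?thesis using that moved by blast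
    next
      case equal
      then show ?thesis using moved by simp
    next
      case greater
      then have "h z < 0" using monotoneD[OF h(2), of 0 z] h(3) by simp
      then show ?thesis using that h_fix moved by blast
    qed
    have K: "diffeomorphism (\<lambda>x. h (h x))" "strict_mono (\<lambda>x. h (h x))"
      using diffeomorphism_comp'[OF h(1) h(1)] strict_antimono_comp_strict_mono[OF h(2)] by auto
    have comm: "f (h (h x)) = h (h (f x))" for x
      by (rule reversal_commutes[of f h, OF f(1) rev])
    \<comment> \<open>Let \<open>p\<close> be the fixed point of \<open>f\<close> nearest to
      \<open>0\<close> on the left. Then \<open>f\<close> or its inverse contracts
      \<open>(p, 0]\<close> towards \<open>p\<close>, and \<open>h^2\<close> commutes with it and
      fixes \<open>0\<close>, so Kopell's lemma makes \<open>h^2\<close> the identity on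
      \<open>[p, 0]\<close>.\<close>
    have "\<exists>p<0. f p = p \<and> (\<forall>x. p \<le> x \<and> x \<le> 0 \<longrightarrow> h (h x) = x)"
    proof (cases "f 0 < 0")
      case True
      obtain p where p: "p < 0" "f p = p" "\<And>x. p < x \<Longrightarrow> x \<le> 0 \<Longrightarrow> f x < x"
        using greatest_fixed_point_below[OF contf p0(1) less_imp_le[OF p0(2)] True] by blast
      have "h (h x) = x" if "p \<le> x" "x \<le> 0" for x
        by (rule Kopell[OF f p(2,3) K comm _ p(1)]) (use h(3) that in auto)
      then show ?thesis using p by blast
    next
      case False
      define k where "k = finv f"
      have k: "diffeomorphism k" "strict_mono k"
        using f diffeomorphism_inv strict_mono_inv_diffeomorphism by (auto simp: k_def)
      have fk [simp]: "f (k x) = x" "k (f x) = x" for x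
        using f by (auto simp: k_def)
      have "0 < f 0"
        using False moved by simp
      then have k0: "k 0 < 0"
        using strict_mono_less[OF f(2), of "k 0" 0] by simp
      have kp0: "k p0 = p0"
        using p0(1) fk(2) by metis
      obtain p where p: "p < 0" "k p = p" "\<And>x. p < x \<Longrightarrow> x \<le> 0 \<Longrightarrow> k x < x"
        using greatest_fixed_point_below[OF smooth_continuous_on[OF diffeomorphism_smooth[OF k(1)]]
            kp0 less_imp_le[OF p0(2)] k0] by blast
      have commk: "k (h (h x)) = h (h (k x))" for x
        by (metis comm fk)
      have "h (h x) = x" if "p \<le> x" "x \<le> 0" for x
        by (rule Kopell[OF k p(2,3) K commk _ p(1)]) (use h(3) that in auto)
      moreover have "f p = p"
        using p(2) fk(1) by metis
      ultimately show ?thesis using p(1) by blast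
    qed
    then obtain p where p: "p < 0" "f p = p" "\<And>x. p \<le> x \<Longrightarrow> x \<le> 0 \<Longrightarrow> h (h x) = x"
      by blast
    have hp: "0 < h p" "f (h p) = h p"
      using monotoneD[OF h(2), of p 0] p(1) h(3) h_fix[OF p(2)] by auto
    \<comment> \<open>For \<open>x > 0\<close> the point \<open>i x\<close> lies in
      \<open>[p, 0]\<close>, and applying \<open>h\<close> carries the equation back to
      \<open>x\<close>.\<close>
    have hh: "h (h x) = x" if "p \<le> x" "x \<le> h p" for x
    proof (cases "x \<le> 0")
      case True
      then show ?thesis using p(3) that by blast
    next
      case False
      have "p \<le> i x" "i x \<le> i 0"
        using strict_antimono_leD[OF i(2) that(2)] strict_antimono_leD[OF i(2), of 0 x] False by
            auto
      then have "h (h (i x)) = i x"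
        using p(3)[of "i x"] i0 by simp
      then show ?thesis by simp
    qed
    have "flat (\<lambda>x. h (h x) - x)"
    proof -
      have "\<forall>\<^sub>F x in nhds 0. x \<in> {p<..<h p}"
        using p(1) hp(1) by (intro eventually_nhds_in_open) auto
      then have "\<forall>\<^sub>F x in nhds 0. h (h x) - x = 0"
        by eventually_elim (simp add: hh)
      then have "(deriv ^^ n) (\<lambda>x. h (h x) - x) 0 = (deriv ^^ n) (\<lambda>_. 0) 0" for n
        by (rule higher_deriv_cong_ev) simp
      moreover have "(deriv ^^ n) (\<lambda>_. 0 :: real) = (\<lambda>_. 0)" for n
        by (induction n) auto
      ultimately show ?thesis by (simp add: flat_def)
    qed
    \<comment> \<open>Points of \<open>[p, h p]\<close> stay there under \<open>f\<close>, and
      \<open>h\<close> is its own inverse on that interval; points outside cannot cross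
      \<open>0\<close>, since \<open>p\<close> and \<open>h p\<close> are fixed by
      \<open>f\<close>.\<close>
    moreover have "(0 \<le> x \<longleftrightarrow> 0 \<le> f x) \<or> h (f x) = finv h (f x)" for x
    proof (cases "p \<le> x \<and> x \<le> h p")
      case True
      then have "p \<le> f x" "f x \<le> h p"
        using strict_mono_less_eq[OF f(2), of p x] strict_mono_less_eq[OF f(2), of x "h p"] p hp
            by auto
      then have "h (h (f x)) = f x" by (rule hh)
      then have "finv h (f x) = h (f x)"
        using h(1) by (metis diffeomorphism_inv_f)
      then show ?thesis by simp
    next
      case False
      then have "x < p \<and> f x < p \<or> h p < x \<and> h p < f x"
        using strict_mono_less[OF f(2), of x p] strict_mono_less[OF f(2), of "h p" x] p hp by auto
      then show ?thesis using p hp by auto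
    qed
    ultimately show ?thesis
      using involution_reverses_glue[OF f(1) h rev] by blast
  qed
qed

text \<open>Conjugating by the translation that moves the fixed point of \<open>h\<close> to
  \<open>0\<close> reduces to the normalised case.\<close>

lemma increasing_reversed_by_decreasing:
  assumes f: "diffeomorphism f" "strict_mono f" and h: "diffeomorphism h" "strict_antimono_on UNIV
      h"
    and rev: "\<And>x. f (h (f x)) = h x"
  shows "involution_reverses f"
proof -
  obtain c where c: "h c = c"
    using strict_antimono_fixed_point[OF smooth_continuous_on[OF diffeomorphism_smooth[OF h(1)]]
        h(2)]
    by blast
  have shift: "diffeomorphism (\<lambda>x. x + a)" for a :: real
  proof (rule diffeomorphismI)
    show "smooth (\<lambda>x. x + a)" by (intro smooth_intros)
    have "((\<lambda>x. x + a) has_real_derivative 1) (at x)" for x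
      by (auto intro!: derivative_eq_intros)
    then show "deriv (\<lambda>x. x + a) x > 0" for x
      using DERIV_imp_deriv by fastforce
    show "surj (\<lambda>x. x + a)" by (rule surjI[of _ "\<lambda>x. x - a"]) simp
  qed
  have conj: "diffeomorphism (\<lambda>x. k (x + c) - c)" if "diffeomorphism k" for k
    using diffeomorphism_comp'[OF shift[of "- c"] diffeomorphism_comp'[OF that shift[of c]]] by simp
  have "involution_reverses (\<lambda>x. f (x + c) - c)"
    by (rule increasing_reversed_by_decreasing_0[where h = "\<lambda>x. h (x + c) - c"])
      (use f h conj c rev in \<open>auto simp: strict_mono_def monotone_def\<close>)
  then obtain t where t: "smooth t" "\<And>x. t (t x) = x" "\<And>x. f (t (f (x + c) - c) + c) - c = t x"
    by (auto simp: involution_reverses_def)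
  define s where "s x = t (x - c) + c" for x
  have "smooth s"
    unfolding s_def by (intro smooth_add smooth_const smooth_comp[OF t(1) smooth_diff[OF
        smooth_ident smooth_const]])
  moreover have "s (s x) = x" for x
    by (simp add: s_def t(2))
  moreover have "f (s (f x)) = s x" for x
    using t(3)[of "x - c"] by (simp add: s_def algebra_simps)
  ultimately show ?thesis
    by (auto simp: involution_reverses_def)
qed

section \<open>From functions to the groups of diffeomorphisms\<close>

lemma conj_eq_inv_Diffeo_iff:
  assumes "f \<in> carrier Diffeo" "h \<in> carrier Diffeo"
  shows "h \<otimes>\<^bsub>Diffeo\<^esub> f \<otimes>\<^bsub>Diffeo\<^esub> inv\<^bsub>Diffeo\<^esub> h = inv\<^bsub>Diffeo\<^esub> f \<longleftrightarrow> (\<forall>x. f (h (f x)) = h x)"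
proof -
  have d: "diffeomorphism f" "diffeomorphism h"
    using assms by (auto simp: Diffeo_def)
  have "h \<otimes>\<^bsub>Diffeo\<^esub> f \<otimes>\<^bsub>Diffeo\<^esub> inv\<^bsub>Diffeo\<^esub> h = inv\<^bsub>Diffeo\<^esub> f \<longleftrightarrow> (\<forall>y. h (f (finv h y)) = finv f y)"
    unfolding inv_Diffeo[OF assms(1)] inv_Diffeo[OF assms(2)] by (simp add: Diffeo_def fun_eq_iff)
  \<comment> \<open>Substituting \<open>y = h x\<close> removes the inverse of \<open>h\<close>;
    applying \<open>f\<close> then removes the inverse of \<open>f\<close>.\<close>
  also have "\<dots> \<longleftrightarrow> (\<forall>x. h (f x) = finv f (h x))"
    using d(2) by (metis diffeomorphism_f_inv diffeomorphism_inv_f)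
  also have "\<dots> \<longleftrightarrow> (\<forall>x. f (h (f x)) = h x)"
    using d(1) by (metis diffeomorphism_f_inv diffeomorphism_inv_f)
  finally show ?thesis .
qed

lemma involution_reverses_imp_strongly_reversible:
  assumes f: "f \<in> carrier Diffeo" and "involution_reverses f"
  shows "strongly_reversible Diffeo f"
proof -
  obtain t where t: "smooth t" "\<And>x. t (t x) = x" "\<And>x. f (t (f x)) = t x"
    using assms by (auto simp: involution_reverses_def)
  then have T: "t \<in> carrier Diffeo"
    using diffeomorphism_involution by (simp add: Diffeo_def)
  moreover have "involution Diffeo t"
    using T t(2) by (simp add: involution_def Diffeo_def fun_eq_iff)
  ultimately show ?thesis
    using conj_eq_inv_Diffeo_iff[OF f T] t(3) by (auto simp: strongly_reversible_def)
qed

theorem theorem1p2: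
  fixes f :: "real \<Rightarrow> real"
  assumes "f \<in> carrier Diffeo"
    and "reversible Diffeo f"
  shows "strongly_reversible Diffeo f
       \<or> (f \<in> carrier Diffeo_plus \<and> reversible Diffeo_plus f)"
proof -
  obtain h where h: "h \<in> carrier Diffeo"
    "h \<otimes>\<^bsub>Diffeo\<^esub> f \<otimes>\<^bsub>Diffeo\<^esub> inv\<^bsub>Diffeo\<^esub> h = inv\<^bsub>Diffeo\<^esub> f"
    using assms(2) by (auto simp: reversible_def)
  then have rev: "\<And>x. f (h (f x)) = h x"
    using conj_eq_inv_Diffeo_iff[OF assms(1)] by blast
  have f: "diffeomorphism f" and dh: "diffeomorphism h"
    using assms(1) h(1) by (auto simp: Diffeo_def)
  from f show ?thesis
  proof (cases rule: diffeomorphism_mono_cases)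
    case dec
    have "f (f x) = x" for x
      by (rule decreasing_reversible_imp_involution[OF f dec(1) dh rev])
    \<comment> \<open>An involution reverses itself, so \<open>f\<close> serves as
      \<open>t\<close>.\<close>
    then have "involution_reverses f"
      unfolding involution_reverses_def using diffeomorphism_smooth[OF f] by auto
    then show ?thesis
      using involution_reverses_imp_strongly_reversible[OF assms(1)] by blast
  next
    case inc
    from dh show ?thesis
    proof (cases rule: diffeomorphism_mono_cases)
      case dec
      then show ?thesis
        using increasing_reversed_by_decreasing[OF f inc(1) dh dec(1) rev]
          involution_reverses_imp_strongly_reversible[OF assms(1)] by blast
    next
      case hinc: inc
      have P: "f \<in> carrier Diffeo_plus" "h \<in> carrier Diffeo_plus"
        using assms(1) h(1) inc(1) hinc(1) by (auto simp: Diffeo_plus_def)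
      \<comment> \<open>Inverses computed in the subgroup agree with those in the whole group, so
        \<open>h\<close> itself witnesses reversibility there.\<close>
      have "inv\<^bsub>Diffeo_plus\<^esub> k = inv\<^bsub>Diffeo\<^esub> k" if "k \<in> carrier Diffeo_plus" for k
        using group.m_inv_consistent[OF group_Diffeo subgroup_Diffeo_plus that]
        by (simp add: Diffeo_plus_def)
      moreover have "x \<otimes>\<^bsub>Diffeo_plus\<^esub> y = x \<otimes>\<^bsub>Diffeo\<^esub> y" for x y
        by (simp add: Diffeo_plus_def)
      ultimately have "reversible Diffeo_plus f"
        using P h(2) by (auto simp: reversible_def)
      with P show ?thesis by blast
    qed
  qed
qed

end
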